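(* Let $(\Omega,\Sigma,\mu)$ be a complete finite measure space and let $E$ be a separable Banach space. If $(\Omega,\Sigma,\mu)$ is saturated, then for every nonempty decomposable subset $K$ of $L^1(\mu,E)$, every separable Banach space $F$, and every continuous linear operator $T:L^1(\mu,E)\to F$, the set $T(K)$ is convex. Conversely, suppose that $E$ is infinite dimensional. If for every nonempty decomposable subset $K$ of $L^1(\mu,E)$, every separable Banach space $F$, and every continuous linear operator $T:L^1(\mu,E)\to F$, the set $T(K)$ is convex, then $(\Omega,\Sigma,\mu)$ is saturated.
   Context: $L^1(\mu,E)$ is the Banach space of ($\mu$-equivalence classes of) Bochner integrable functions $f:\Omega\to E$ with norm $\|f\|_1=\int\|f(\omega)\|\,d\mu$. A subset $K$ of $L^1(\mu,E)$ is decomposable if $\chi_A f+(1-\chi_A)g\in K$ for every $f,g\in K$ and every $A\in\Sigma$, where $\chi_A$ is the characteristic function of $A$. For $S\in\Sigma$, let $\Sigma_S=\{A\cap S\mid A\in\Sigma\}$, and let $L^1_S(\mu)$ denote the space of (real-valued) $\mu$-integrable functions on the measurable space $(S,\Sigma_S)$, i.e. the restrictions to $S$ of the functions in $L^1(\mu)$. A finite measure space $(\Omega,\Sigma,\mu)$ is saturated if $L^1_S(\mu)$ is nonseparable for every $S\in\Sigma$ with $\mu(S)>0$. *)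

theory Defs
  imports "HOL-Analysis.Analysis"
begin

text \<open>
  The statement quantifies over all separable Banach spaces inside a formula, and \<open>L1\<close> spaces depend
  on a measure, so neither can be types. Real normed spaces are therefore given by an explicit
  carrier and operations; only their values on the carrier matter.
\<close>

record 'v nvs =
  vcarrier :: "'v set"
  vzero :: 'v
  vadd :: "'v \<Rightarrow> 'v \<Rightarrow> 'v"
  vscale :: "real \<Rightarrow> 'v \<Rightarrow> 'v"
  vnorm :: "'v \<Rightarrow> real"

locale normed_vs =
  fixes V :: "'v nvs"
  assumes zero_closed: "vzero V \<in> vcarrier V"
    and add_closed: "\<lbrakk>x \<in> vcarrier V; y \<in> vcarrier V\<rbrakk> \<Longrightarrow> vadd V x y \<in> vcarrier V"
    and scale_closed: "x \<in> vcarrier V \<Longrightarrow> vscale V c x \<in> vcarrier V"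
    and add_assoc: "\<lbrakk>x \<in> vcarrier V; y \<in> vcarrier V; z \<in> vcarrier V\<rbrakk>
          \<Longrightarrow> vadd V (vadd V x y) z = vadd V x (vadd V y z)"
    and add_commute: "\<lbrakk>x \<in> vcarrier V; y \<in> vcarrier V\<rbrakk> \<Longrightarrow> vadd V x y = vadd V y x"
    and add_zero: "x \<in> vcarrier V \<Longrightarrow> vadd V x (vzero V) = x"
    and add_inverse: "x \<in> vcarrier V \<Longrightarrow> \<exists>y\<in>vcarrier V. vadd V x y = vzero V"
    and scale_add_right: "\<lbrakk>x \<in> vcarrier V; y \<in> vcarrier V\<rbrakk>
          \<Longrightarrow> vscale V c (vadd V x y) = vadd V (vscale V c x) (vscale V c y)"
    and scale_add_left: "x \<in> vcarrier V
          \<Longrightarrow> vscale V (b + c) x = vadd V (vscale V b x) (vscale V c x)"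
    and scale_scale: "x \<in> vcarrier V \<Longrightarrow> vscale V b (vscale V c x) = vscale V (b * c) x"
    and scale_one: "x \<in> vcarrier V \<Longrightarrow> vscale V 1 x = x"
    and norm_nonneg: "x \<in> vcarrier V \<Longrightarrow> 0 \<le> vnorm V x"
    and norm_eq_zero: "x \<in> vcarrier V \<Longrightarrow> vnorm V x = 0 \<longleftrightarrow> x = vzero V"
    and norm_scale: "x \<in> vcarrier V \<Longrightarrow> vnorm V (vscale V c x) = \<bar>c\<bar> * vnorm V x"
    and norm_triangle: "\<lbrakk>x \<in> vcarrier V; y \<in> vcarrier V\<rbrakk>
          \<Longrightarrow> vnorm V (vadd V x y) \<le> vnorm V x + vnorm V y"

text \<open>The value 0 off the carrier is needed because \<^locale>\<open>Metric_space\<close> demands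
  nonnegativity and symmetry of the distance on the whole type.\<close>

definition vdist :: "'v nvs \<Rightarrow> 'v \<Rightarrow> 'v \<Rightarrow> real" where
  "vdist V x y = (if x \<in> vcarrier V \<and> y \<in> vcarrier V
                  then vnorm V (vadd V x (vscale V (-1) y)) else 0)"

definition vtopology :: "'v nvs \<Rightarrow> 'v topology" where
  "vtopology V = Metric_space.mtopology (vcarrier V) (vdist V)"

definition banach_vs :: "'v nvs \<Rightarrow> bool" where
  "banach_vs V \<longleftrightarrow> normed_vs V \<and> Metric_space.mcomplete (vcarrier V) (vdist V)"

definition separable_banach_vs :: "'v nvs \<Rightarrow> bool" where
  "separable_banach_vs V \<longleftrightarrow> banach_vs V \<and> separable_space (vtopology V)"

definition continuous_linear_vs :: "'v nvs \<Rightarrow> 'w nvs \<Rightarrow> ('v \<Rightarrow> 'w) \<Rightarrow> bool" where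
  "continuous_linear_vs V W T \<longleftrightarrow>
     T \<in> vcarrier V \<rightarrow> vcarrier W \<and>
     (\<forall>x\<in>vcarrier V. \<forall>y\<in>vcarrier V. T (vadd V x y) = vadd W (T x) (T y)) \<and>
     (\<forall>c. \<forall>x\<in>vcarrier V. T (vscale V c x) = vscale W c (T x)) \<and>
     continuous_map (vtopology V) (vtopology W) T"

definition convex_vs :: "'v nvs \<Rightarrow> 'v set \<Rightarrow> bool" where
  "convex_vs V C \<longleftrightarrow>
     (\<forall>x\<in>C. \<forall>y\<in>C. \<forall>u\<ge>0. \<forall>v\<ge>0. u + v = 1 \<longrightarrow> vadd V (vscale V u x) (vscale V v y) \<in> C)"


text \<open>Elements of \<open>L1 M\<close> are equivalence classes of integrable functions modulo equality almost
  everywhere; \<open>L1_rep\<close> picks a representative, on which none of the operations below depends.\<close>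

definition L1_class :: "'a measure \<Rightarrow> ('a \<Rightarrow> 'e::{banach, second_countable_topology}) \<Rightarrow> ('a \<Rightarrow> 'e) set" where
  "L1_class M f = {g. integrable M g \<and> (AE \<omega> in M. g \<omega> = f \<omega>)}"

definition L1_rep :: "('a \<Rightarrow> 'e) set \<Rightarrow> 'a \<Rightarrow> 'e" where
  "L1_rep X = (SOME f. f \<in> X)"

definition L1 :: "'a measure \<Rightarrow> ('a \<Rightarrow> 'e::{banach, second_countable_topology}) set nvs" where
  "L1 M = \<lparr>vcarrier = L1_class M ` {f. integrable M f},
           vzero = L1_class M (\<lambda>_. 0),
           vadd = (\<lambda>X Y. L1_class M (\<lambda>\<omega>. L1_rep X \<omega> + L1_rep Y \<omega>)),
           vscale = (\<lambda>c X. L1_class M (\<lambda>\<omega>. c *\<^sub>R L1_rep X \<omega>)),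
           vnorm = (\<lambda>X. \<integral>\<omega>. norm (L1_rep X \<omega>) \<partial>M)\<rparr>"

definition decomposable :: "'a measure \<Rightarrow> ('a \<Rightarrow> 'e::{banach, second_countable_topology}) set set \<Rightarrow> bool" where
  "decomposable M K \<longleftrightarrow> K \<subseteq> vcarrier (L1 M) \<and>
     (\<forall>X\<in>K. \<forall>Y\<in>K. \<forall>A\<in>sets M.
        L1_class M (\<lambda>\<omega>. indicator A \<omega> *\<^sub>R L1_rep X \<omega> + (1 - indicator A \<omega>) *\<^sub>R L1_rep Y \<omega>) \<in> K)"

definition saturated :: "'a measure \<Rightarrow> bool" where
  "saturated M \<longleftrightarrow> finite_measure M \<and>
     (\<forall>S\<in>sets M. measure M S > 0 \<longrightarrow>
        \<not> separable_space (vtopology (L1 (restrict_space M S) :: ('a \<Rightarrow> real) set nvs)))"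


text \<open>Sanity checks: \<open>L1 M\<close> is a normed space with the expected operations on classes, and up to
  isometric isomorphism every separable Banach space, on whatever type, has its carrier in
  \<^typ>\<open>nat \<Rightarrow> real\<close>, so that quantifying over structures of type \<open>(nat \<Rightarrow> real) nvs\<close> is
  quantifying over all separable Banach spaces.\<close>

lemma L1_class_eqI: "AE \<omega> in M. f \<omega> = g \<omega> \<Longrightarrow> L1_class M f = L1_class M g"
proof -
  assume fg: "AE \<omega> in M. f \<omega> = g \<omega>"
  have "(AE \<omega> in M. h \<omega> = f \<omega>) \<longleftrightarrow> (AE \<omega> in M. h \<omega> = g \<omega>)" for h
    by (rule eventually_cong[OF fg]) simp
  then show ?thesis by (simp add: L1_class_def)
qed

lemma L1_rep_in: "integrable M f \<Longrightarrow> L1_rep (L1_class M f) \<in> L1_class M f"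
  unfolding L1_rep_def by (rule someI[of _ f]) (simp add: L1_class_def)

lemma L1_rep_integrable: "integrable M f \<Longrightarrow> integrable M (L1_rep (L1_class M f))"
  using L1_rep_in[of M f] by (simp add: L1_class_def)

lemma L1_rep_AE: "integrable M f \<Longrightarrow> AE \<omega> in M. L1_rep (L1_class M f) \<omega> = f \<omega>"
  using L1_rep_in[of M f] by (simp add: L1_class_def)

lemma L1_class_eq_iff:
  "integrable M f \<Longrightarrow> L1_class M f = L1_class M g \<longleftrightarrow> (AE \<omega> in M. f \<omega> = g \<omega>)"
proof
  assume f: "integrable M f" and "L1_class M f = L1_class M g"
  moreover have "f \<in> L1_class M f" using f by (simp add: L1_class_def)
  ultimately show "AE \<omega> in M. f \<omega> = g \<omega>" by (simp add: L1_class_def)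
qed (rule L1_class_eqI)

lemma L1_carrier: "vcarrier (L1 M) = L1_class M ` {f. integrable M f}"
  and L1_zero: "vzero (L1 M) = L1_class M (\<lambda>_. 0)"
  by (simp_all add: L1_def)

lemma L1_add:
  assumes "integrable M f" "integrable M g"
  shows "vadd (L1 M) (L1_class M f) (L1_class M g) = L1_class M (\<lambda>\<omega>. f \<omega> + g \<omega>)"
  unfolding L1_def nvs.simps
  by (rule L1_class_eqI, rule eventually_elim2[OF assms[THEN L1_rep_AE]]) simp

lemma L1_scale:
  assumes "integrable M f"
  shows "vscale (L1 M) c (L1_class M f) = L1_class M (\<lambda>\<omega>. c *\<^sub>R f \<omega>)"
  unfolding L1_def nvs.simps
  by (rule L1_class_eqI, rule eventually_mono[OF L1_rep_AE]) (use assms in auto)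

lemma L1_norm:
  assumes "integrable M f"
  shows "vnorm (L1 M) (L1_class M f) = (\<integral>\<omega>. norm (f \<omega>) \<partial>M)"
proof -
  have "AE \<omega> in M. norm (L1_rep (L1_class M f) \<omega>) = norm (f \<omega>)"
    by (rule eventually_mono[OF L1_rep_AE]) (use assms in auto)
  then show ?thesis
    unfolding L1_def
    by (auto intro!: integral_cong_AE borel_measurable_norm borel_measurable_integrable
        L1_rep_integrable assms)
qed

lemma decomposable_mem:
  assumes "decomposable M K" "A \<in> sets M" "integrable M f" "integrable M g"
    "L1_class M f \<in> K" "L1_class M g \<in> K"
  shows "L1_class M (\<lambda>\<omega>. indicator A \<omega> *\<^sub>R f \<omega> + (1 - indicator A \<omega>) *\<^sub>R g \<omega>) \<in> K"
proof -
  have "L1_class M (\<lambda>\<omega>. indicator A \<omega> *\<^sub>R L1_rep (L1_class M f) \<omega>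
          + (1 - indicator A \<omega>) *\<^sub>R L1_rep (L1_class M g) \<omega>)
      = L1_class M (\<lambda>\<omega>. indicator A \<omega> *\<^sub>R f \<omega> + (1 - indicator A \<omega>) *\<^sub>R g \<omega>)"
    by (rule L1_class_eqI, rule eventually_elim2[OF assms(3,4)[THEN L1_rep_AE]]) simp
  moreover have "L1_class M (\<lambda>\<omega>. indicator A \<omega> *\<^sub>R L1_rep (L1_class M f) \<omega>
          + (1 - indicator A \<omega>) *\<^sub>R L1_rep (L1_class M g) \<omega>) \<in> K"
    using assms(1,2,5,6) unfolding decomposable_def by blast
  ultimately show ?thesis by simp
qed

lemma normed_vs_L1: "normed_vs (L1 M :: ('a \<Rightarrow> 'e::{banach, second_countable_topology}) set nvs)"
proof
  fix x :: "('a \<Rightarrow> 'e) set"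
  assume "x \<in> vcarrier (L1 M)"
  then obtain f where f: "integrable M f" "x = L1_class M f" by (auto simp: L1_carrier)
  show "\<exists>y\<in>vcarrier (L1 M). vadd (L1 M) x y = vzero (L1 M)"
    by (rule bexI[of _ "L1_class M (\<lambda>\<omega>. - f \<omega>)"])
      (use f in \<open>auto simp: L1_add L1_carrier L1_zero\<close>)
  show "vnorm (L1 M) x = 0 \<longleftrightarrow> x = vzero (L1 M)"
    using f by (simp add: L1_norm L1_zero L1_class_eq_iff integral_nonneg_eq_0_iff_AE)
  fix y :: "('a \<Rightarrow> 'e) set"
  assume "y \<in> vcarrier (L1 M)"
  then obtain g where g: "integrable M g" "y = L1_class M g" by (auto simp: L1_carrier)
  have "(\<integral>\<omega>. norm (f \<omega> + g \<omega>) \<partial>M) \<le> (\<integral>\<omega>. norm (f \<omega>) + norm (g \<omega>) \<partial>M)"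
    using f g by (intro integral_mono) (auto intro: norm_triangle_ineq)
  then show "vnorm (L1 M) (vadd (L1 M) x y) \<le> vnorm (L1 M) x + vnorm (L1 M) y"
    using f g by (simp add: L1_add L1_norm)
qed (auto simp: L1_carrier L1_zero L1_add L1_scale L1_norm scaleR_add_left scaleR_add_right
      add_ac)

context normed_vs
begin

lemma zero_scale: "x \<in> vcarrier V \<Longrightarrow> vscale V 0 x = vzero V"
  using norm_eq_zero[of "vscale V 0 x"] norm_scale[of x 0] scale_closed[of x 0] by simp

lemma add_neg: "x \<in> vcarrier V \<Longrightarrow> vadd V x (vscale V (-1) x) = vzero V"
  using scale_add_left[of x 1 "-1"] by (simp add: scale_one zero_scale)

lemma diff_zero_iff:
  assumes "x \<in> vcarrier V" "y \<in> vcarrier V"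
  shows "vadd V x (vscale V (-1) y) = vzero V \<longleftrightarrow> x = y"
proof
  assume "vadd V x (vscale V (-1) y) = vzero V"
  then have "vadd V (vadd V x (vscale V (-1) y)) y = y"
    using assms by (metis add_commute add_zero zero_closed)
  moreover have "vadd V (vadd V x (vscale V (-1) y)) y = x"
    using assms by (metis add_assoc add_commute add_neg add_zero scale_closed)
  ultimately show "x = y" by simp
qed (use assms add_neg in auto)

sublocale Metric_space "vcarrier V" "vdist V"
proof
  fix x y
  show "0 \<le> vdist V x y"
    by (simp add: vdist_def norm_nonneg add_closed scale_closed)
  show "vdist V x y = vdist V y x"
  proof (cases "x \<in> vcarrier V \<and> y \<in> vcarrier V")
    case True
    then have "vscale V (-1) (vadd V x (vscale V (-1) y)) = vadd V y (vscale V (-1) x)"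
      by (simp add: scale_add_right scale_closed scale_scale scale_one add_commute)
    then show ?thesis
      using True norm_scale[of "vadd V x (vscale V (-1) y)" "-1"]
      by (simp add: vdist_def add_closed scale_closed)
  qed (auto simp: vdist_def)
next
  fix x y assume "x \<in> vcarrier V" "y \<in> vcarrier V"
  then show "vdist V x y = 0 \<longleftrightarrow> x = y"
    by (simp add: vdist_def norm_eq_zero add_closed scale_closed diff_zero_iff)
next
  fix x y z assume xyz: "x \<in> vcarrier V" "y \<in> vcarrier V" "z \<in> vcarrier V"
  let ?d = "\<lambda>x y. vadd V x (vscale V (-1) y)"
  have "vadd V (?d x y) (?d y z) = vadd V x (vadd V (vadd V (vscale V (-1) y) y) (vscale V (-1) z))"
    using xyz by (simp add: add_assoc add_closed scale_closed)
  also have "\<dots> = ?d x z"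
    using xyz by (metis add_neg add_commute add_zero scale_closed zero_closed)
  finally show "vdist V x z \<le> vdist V x y + vdist V y z"
    using norm_triangle[of "?d x y" "?d y z"] xyz
    by (simp add: vdist_def add_closed scale_closed)
qed

end

lemma separable_banach_vs_copy:
  fixes V :: "'v nvs"
  assumes V: "separable_banach_vs V"
  obtains W :: "(nat \<Rightarrow> real) nvs" and \<phi> where
    "separable_banach_vs W" "bij_betw \<phi> (vcarrier V) (vcarrier W)"
    "continuous_linear_vs V W \<phi>" "\<And>x. x \<in> vcarrier V \<Longrightarrow> vnorm W (\<phi> x) = vnorm V x"
proof -
  interpret V: normed_vs V using V by (simp add: separable_banach_vs_def banach_vs_def)
  obtain C where C: "countable C" "C \<subseteq> vcarrier V" "V.mtopology closure_of C = vcarrier V"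
    using V by (auto simp: separable_banach_vs_def separable_space_def vtopology_def)
  have "C \<noteq> {}" using C V.zero_closed by force
  define d where "d = from_nat_into C"
  have d: "range d = C" using C \<open>C \<noteq> {}\<close> by (simp add: d_def range_from_nat_into)
  define \<phi> where "\<phi> x n = vdist V x (d n)" for x n
  define \<psi> where "\<psi> = inv_into (vcarrier V) \<phi>"
  have inj: "inj_on \<phi> (vcarrier V)"
  proof (rule inj_onI, rule ccontr)
    fix x y assume xy: "x \<in> vcarrier V" "y \<in> vcarrier V" "\<phi> x = \<phi> y" "x \<noteq> y"
    define r where "r = vdist V x y / 2"
    have "r > 0" using xy by (simp add: r_def)
    then obtain n where n: "d n \<in> V.mball x r"
      using C(3) xy(1) d by (fastforce simp: V.metric_closure_of)
    then have "vdist V y (d n) < r" using fun_cong[OF xy(3), of n] by (auto simp: \<phi>_def)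
    moreover have "vdist V x (d n) < r" using n by auto
    moreover have "vdist V x y \<le> vdist V x (d n) + vdist V y (d n)"
      using V.triangle[of x "d n" y] xy n by (auto simp: V.commute)
    ultimately show False by (simp add: r_def)
  qed
  then have [simp]: "\<psi> (\<phi> x) = x" if "x \<in> vcarrier V" for x
    using that by (simp add: \<psi>_def)
  define W where "W = \<lparr>vcarrier = \<phi> ` vcarrier V, vzero = \<phi> (vzero V),
    vadd = (\<lambda>x y. \<phi> (vadd V (\<psi> x) (\<psi> y))), vscale = (\<lambda>c x. \<phi> (vscale V c (\<psi> x))),
    vnorm = (\<lambda>x. vnorm V (\<psi> x))\<rparr>"
  note cl = V.zero_closed V.add_closed V.scale_closed
  interpret W: normed_vs W
  proof
    fix x assume "x \<in> vcarrier W"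
    then obtain x' where x': "x' \<in> vcarrier V" "x = \<phi> x'" by (auto simp: W_def)
    then obtain y' where "y' \<in> vcarrier V" "vadd V x' y' = vzero V" using V.add_inverse by blast
    then show "\<exists>y\<in>vcarrier W. vadd W x y = vzero W" using x' by (auto simp: W_def intro!: bexI[of _ y'])
    show "vnorm W x = 0 \<longleftrightarrow> x = vzero W"
      using x' inj cl by (auto simp: W_def V.norm_eq_zero dest: inj_onD)
  qed (auto simp: W_def cl V.add_assoc V.add_zero V.scale_add_right V.scale_add_left
        V.scale_scale V.scale_one V.norm_nonneg V.norm_scale V.norm_triangle
        intro!: arg_cong[where f = \<phi>] intro: V.add_commute)
  have cW: "vcarrier W = \<phi> ` vcarrier V" by (simp add: W_def)
  have dW: "vdist W (\<phi> x) (\<phi> y) = vdist V x y" if "x \<in> vcarrier V" "y \<in> vcarrier V" for x y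
    using that by (simp add: vdist_def W_def cl)
  interpret VW: Metric_space12 "vcarrier V" "vdist V" "vcarrier W" "vdist W" ..
  have hom: "homeomorphic_map V.mtopology W.mtopology \<phi>"
    by (rule VW.isometry_imp_homeomorphic_map) (auto simp: cW dW)
  have "separable_space W.mtopology"
    using V hom homeomorphic_separable_space homeomorphic_map_imp_homeomorphic_space
    by (metis separable_banach_vs_def vtopology_def)
  moreover have "W.mcomplete"
    unfolding W.mcomplete_def
  proof (intro allI impI)
    fix \<sigma> assume \<sigma>: "W.MCauchy \<sigma>"
    then have "range \<sigma> \<subseteq> vcarrier W" by (simp add: W.MCauchy_def)
    then have r: "\<sigma> n \<in> \<phi> ` vcarrier V" for n by (auto simp: cW)
    then have p: "\<psi> (\<sigma> n) \<in> vcarrier V" "\<phi> (\<psi> (\<sigma> n)) = \<sigma> n" for n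
      by (auto simp: \<psi>_def inv_into_into f_inv_into_f)
    have "vdist V (\<psi> (\<sigma> m)) (\<psi> (\<sigma> n)) = vdist W (\<sigma> m) (\<sigma> n)" for m n
      using dW[OF p(1) p(1)] p(2) by simp
    then have "V.MCauchy (\<psi> \<circ> \<sigma>)" using \<sigma> p(1) by (auto simp: V.MCauchy_def W.MCauchy_def)
    then obtain l where "limitin V.mtopology (\<psi> \<circ> \<sigma>) l sequentially"
      using V by (auto simp: separable_banach_vs_def banach_vs_def V.mcomplete_def)
    then have "limitin W.mtopology (\<phi> \<circ> (\<psi> \<circ> \<sigma>)) (\<phi> l) sequentially"
      using hom by (intro continuous_map_limit) (auto intro: homeomorphic_imp_continuous_map)
    moreover have "\<phi> \<circ> (\<psi> \<circ> \<sigma>) = \<sigma>" using p(2) by auto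
    ultimately show "\<exists>l. limitin W.mtopology \<sigma> l sequentially" by auto
  qed
  ultimately have "separable_banach_vs W"
    by (simp add: separable_banach_vs_def banach_vs_def vtopology_def W.normed_vs_axioms)
  moreover have "bij_betw \<phi> (vcarrier V) (vcarrier W)"
    using inj by (simp add: bij_betw_def cW)
  moreover have "continuous_linear_vs V W \<phi>"
    using homeomorphic_imp_continuous_map[OF hom]
    by (auto simp: continuous_linear_vs_def vtopology_def W_def)
  moreover have "vnorm W (\<phi> x) = vnorm V x" if "x \<in> vcarrier V" for x
    using that by (simp add: W_def)
  ultimately show thesis by (rule that)
qed

end

theory Submission
  imports Defs "HOL-Probability.Conditional_Expectation"
begin

text \<open>
  Let \<open>M\<close> be saturated, \<open>X = [f]\<close> and \<open>Y = [g]\<close> in \<open>K\<close>, \<open>h = f - g\<close>. It suffices to find a set \<open>A\<close> with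
  \<open>T(\<chi>\<^sub>A h) = u T(h)\<close>. Countably many norming functionals \<open>q\<close> separate the points of \<open>F\<close>, and each measure
  \<open>A \<mapsto> q(T(\<chi>\<^sub>A h))\<close> has an integrable density \<open>k\<^sub>q\<close>. These densities are measurable for a countably
  generated \<open>\<sigma>\<close>-algebra \<open>G\<close>. If on some non-null \<open>S\<close> every measurable set coincided almost everywhere
  with a member of \<open>G\<close>, then \<open>L\<^sup>1\<^sub>S\<close> would be separable; so \<open>M\<close> is relatively atomless over \<open>G\<close>, and by
  Maharam's lemma there is \<open>A\<close> whose conditional probability given \<open>G\<close> is the constant \<open>u\<close>. Hence
  \<open>q(T(\<chi>\<^sub>A h)) = \<integral>\<^sub>A k\<^sub>q = u \<integral> k\<^sub>q = u q(T h)\<close> for all \<open>q\<close>. This replaces the usual extreme point argument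
  for Lyapunov's theorem.

  Conversely, if \<open>L\<^sup>1\<^sub>S\<close> is separable with \<open>S\<close> non-null, then so is \<open>L\<^sup>1\<^sub>S(\<mu>, E)\<close>, the restriction
  \<open>L\<^sup>1(\<mu>, E) \<rightarrow> L\<^sup>1\<^sub>S(\<mu>, E)\<close> is an admissible operator, and the image of the decomposable set
  \<open>{\<chi>\<^sub>A e | A \<in> \<Sigma>}\<close> with \<open>e \<noteq> 0\<close> does not contain \<open>\<chi>\<^sub>S e / 2\<close>.
\<close>

subsection \<open>Sublinear functionals and the Hahn--Banach theorem\<close>

context normed_vs
begin

definition sublinear :: "('v \<Rightarrow> real) \<Rightarrow> bool" where
  "sublinear q \<longleftrightarrow>
     (\<forall>x\<in>vcarrier V. \<forall>y\<in>vcarrier V. q (vadd V x y) \<le> q x + q y) \<and>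
     (\<forall>x\<in>vcarrier V. \<forall>c\<ge>0. q (vscale V c x) = c * q x)"

lemma sublinear_add:
  "\<lbrakk>sublinear q; x \<in> vcarrier V; y \<in> vcarrier V\<rbrakk> \<Longrightarrow> q (vadd V x y) \<le> q x + q y"
  and sublinear_scale: "\<lbrakk>sublinear q; x \<in> vcarrier V; 0 \<le> c\<rbrakk> \<Longrightarrow> q (vscale V c x) = c * q x"
  by (auto simp: sublinear_def)

lemma sublinear_zero: "sublinear q \<Longrightarrow> q (vzero V) = 0"
  using sublinear_scale[of q "vzero V" 0] by (simp add: zero_closed zero_scale)

lemma sublinear_neg_lower:
  assumes "sublinear q" "x \<in> vcarrier V"
  shows "- q (vscale V (-1) x) \<le> q x"
  using sublinear_add[OF assms scale_closed[OF assms(2), of "-1"]] add_neg[OF assms(2)]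
    sublinear_zero[OF assms(1)] by simp

text \<open>
  Shifting in direction \<open>x\<close> lowers \<open>q\<close> to a sublinear functional \<open>q'\<close> with \<open>q'(-x) \<le> -q(x)\<close>. A minimal
  sublinear functional is not changed by it, so it is odd and hence linear.
\<close>

definition shift :: "('v \<Rightarrow> real) \<Rightarrow> 'v \<Rightarrow> 'v \<Rightarrow> real" where
  "shift q x y = (INF t\<in>{0..}. q (vadd V y (vscale V t x)) - t * q x)"

text \<open>The infimum defining \<open>shift\<close> is finite: subadditivity at y + t x and -y
  gives t q(x) - q(-y) \<le> q(y + t x), so -q(-y) is a lower bound that does not depend on
  t.\<close>

lemma shift_upper:
  assumes q: "sublinear q" and x: "x \<in> vcarrier V" and y: "y \<in> vcarrier V" and s: "0 \<le> s"
  shows "shift q x y \<le> q (vadd V y (vscale V s x)) - s * q x"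
proof -
  have *: "bdd_below ((\<lambda>t. q (vadd V y (vscale V t x)) - t * q x) ` {0..})"
  proof (rule bdd_belowI2)
    fix t :: real assume t: "t \<in> {0..}"
    have "vadd V (vadd V y (vscale V t x)) (vscale V (-1) y) = vscale V t x"
      using x y by (metis add_assoc add_commute add_neg add_zero scale_closed)
    then show "- q (vscale V (-1) y) \<le> q (vadd V y (vscale V t x)) - t * q x"
      using sublinear_add[OF q, of "vadd V y (vscale V t x)" "vscale V (-1) y"] t x y
      by (simp add: add_closed scale_closed sublinear_scale[OF q])
  qed
  show ?thesis
    unfolding shift_def using s by (intro cINF_lower[OF *]) auto
qed

lemma shift_greatest:
  "(\<And>t. 0 \<le> t \<Longrightarrow> m \<le> q (vadd V y (vscale V t x)) - t * q x) \<Longrightarrow> m \<le> shift q x y"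
  unfolding shift_def by (rule cINF_greatest) auto

lemma shift_le: "\<lbrakk>sublinear q; x \<in> vcarrier V; y \<in> vcarrier V\<rbrakk> \<Longrightarrow> shift q x y \<le> q y"
  using shift_upper[of q x y 0] by (simp add: zero_scale add_zero)

lemma shift_neg: "\<lbrakk>sublinear q; x \<in> vcarrier V\<rbrakk> \<Longrightarrow> shift q x (vscale V (-1) x) \<le> - q x"
  using shift_upper[of q x "vscale V (-1) x" 1]
  by (simp add: scale_one scale_closed add_commute[of "vscale V (-1) x"] add_neg sublinear_zero)

text \<open>For subadditivity, parameters s for y and t for z are tested against s + t for y + z,
  and the infima are taken one after the other. For homogeneity, replacing t by c t gives one
  inequality for every c > 0; the reverse one is the same inequality for 1/c.\<close>

lemma sublinear_shift:
  assumes q: "sublinear q" and x: "x \<in> vcarrier V"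
  shows "sublinear (shift q x)"
  unfolding sublinear_def
proof (intro conjI ballI allI impI)
  fix y z assume y: "y \<in> vcarrier V" and z: "z \<in> vcarrier V"
  have "shift q x (vadd V y z) - (q (vadd V z (vscale V t x)) - t * q x)
      \<le> q (vadd V y (vscale V s x)) - s * q x" if "0 \<le> s" "0 \<le> t" for s t
  proof -
    have "vadd V (vadd V y z) (vscale V (s + t) x)
        = vadd V (vadd V y (vscale V s x)) (vadd V z (vscale V t x))"
      using x y z by (smt (verit) add_assoc add_commute add_closed scale_closed scale_add_left)
    then have "q (vadd V (vadd V y z) (vscale V (s + t) x))
        \<le> q (vadd V y (vscale V s x)) + q (vadd V z (vscale V t x))"
      using sublinear_add[OF q] x y z by (simp add: add_closed scale_closed)
    moreover have "shift q x (vadd V y z) \<le> q (vadd V (vadd V y z) (vscale V (s + t) x)) - (s + t) * q x"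
      using shift_upper[OF q x, of "vadd V y z" "s + t"] that y z by (simp add: add_closed)
    ultimately show ?thesis by (simp add: algebra_simps)
  qed
  then have "shift q x (vadd V y z) - (q (vadd V z (vscale V t x)) - t * q x) \<le> shift q x y"
    if "0 \<le> t" for t
    using that by (intro shift_greatest) auto
  then have "shift q x (vadd V y z) - shift q x y \<le> q (vadd V z (vscale V t x)) - t * q x"
    if "0 \<le> t" for t
    using that by (simp add: algebra_simps)
  then have "shift q x (vadd V y z) - shift q x y \<le> shift q x z"
    by (intro shift_greatest) auto
  then show "shift q x (vadd V y z) \<le> shift q x y + shift q x z" by simp
next
  fix y c assume y: "y \<in> vcarrier V" and c: "0 \<le> (c::real)"
  have le: "shift q x (vscale V c y) \<le> c * shift q x y" if c: "0 < c" and y: "y \<in> vcarrier V" for c y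
  proof -
    have "shift q x (vscale V c y) / c \<le> q (vadd V y (vscale V t x)) - t * q x" if "0 \<le> t" for t
    proof -
      have "q (vadd V (vscale V c y) (vscale V (c * t) x)) = c * q (vadd V y (vscale V t x))"
        using c x y sublinear_scale[OF q, of "vadd V y (vscale V t x)" c]
        by (simp add: scale_add_right scale_scale scale_closed add_closed)
      then show ?thesis
        using shift_upper[OF q x, of "vscale V c y" "c * t"] that y c
        by (simp add: scale_closed field_simps)
    qed
    then have "shift q x (vscale V c y) / c \<le> shift q x y" by (rule shift_greatest)
    then show ?thesis using c by (simp add: field_simps)
  qed
  show "shift q x (vscale V c y) = c * shift q x y"
  proof (cases "c = 0")
    case True
    have "q (vadd V (vzero V) (vscale V t x)) - t * q x = 0" if "0 \<le> t" for t
      using that x by (metis add_commute add_zero scale_closed zero_closed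
          sublinear_scale[OF q] diff_self)
    then have "shift q x (vzero V) = 0" by (simp add: shift_def)
    then show ?thesis using True y by (simp add: zero_scale)
  next
    case False
    then have c: "0 < c" using c by simp
    then have "vscale V (1 / c) (vscale V c y) = y"
      using y by (simp add: scale_scale scale_one)
    then have "shift q x y \<le> (1 / c) * shift q x (vscale V c y)"
      using le[of "1 / c" "vscale V c y"] c y by (simp add: scale_closed)
    then show ?thesis using le[OF c y] c by (simp add: field_simps)
  qed
qed

section \<open>Linear functionals from minimal sublinear ones\<close>

definition linear_functional :: "('v \<Rightarrow> real) \<Rightarrow> bool" where
  "linear_functional q \<longleftrightarrow>
     (\<forall>x\<in>vcarrier V. \<forall>y\<in>vcarrier V. q (vadd V x y) = q x + q y) \<and>
     (\<forall>x\<in>vcarrier V. \<forall>c. q (vscale V c x) = c * q x)"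

text \<open>Oddness turns subadditivity for x = (x + y) + (-y) into the missing inequality q(x) +
  q(y) \<le> q(x + y).\<close>

lemma sublinear_odd_imp_linear:
  assumes q: "sublinear q" and odd: "\<And>x. x \<in> vcarrier V \<Longrightarrow> q (vscale V (-1) x) = - q x"
  shows "linear_functional q"
  unfolding linear_functional_def
proof (intro conjI ballI allI)
  fix x y assume xy: "x \<in> vcarrier V" "y \<in> vcarrier V"
  have "q (vadd V x y) \<le> q x + q y"
    using sublinear_add[OF q] xy by simp
  moreover have "vadd V (vadd V x y) (vscale V (-1) y) = x"
    using xy by (metis add_assoc add_neg add_zero scale_closed)
  then have "q x \<le> q (vadd V x y) - q y"
    using sublinear_add[OF q, of "vadd V x y" "vscale V (-1) y"] xy odd
    by (simp add: add_closed scale_closed)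
  ultimately show "q (vadd V x y) = q x + q y" by simp
next
  fix x c assume x: "x \<in> vcarrier V"
  show "q (vscale V c x) = c * q x"
  proof (cases "0 \<le> c")
    case False
    have "vscale V (-1) (vscale V (-c) x) = vscale V c x"
      using x by (simp add: scale_scale)
    then show ?thesis
      using odd[OF scale_closed[OF x], of "-c"] sublinear_scale[OF q x, of "-c"] False by simp
  qed (simp add: sublinear_scale[OF q x])
qed

text \<open>Subadditivity survives the infimum because of two members of a chain the smaller one can
  be used at x and at y simultaneously.\<close>

lemma sublinear_Inf_chain:
  assumes C: "C \<noteq> {}" "\<And>q. q \<in> C \<Longrightarrow> sublinear q"
    and chain: "\<And>q r. \<lbrakk>q \<in> C; r \<in> C\<rbrakk> \<Longrightarrow> (\<forall>x\<in>vcarrier V. q x \<le> r x) \<or> (\<forall>x\<in>vcarrier V. r x \<le> q x)"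
    and bdd: "\<And>x. x \<in> vcarrier V \<Longrightarrow> bdd_below ((\<lambda>q. q x) ` C)"
  shows "sublinear (\<lambda>x. INF q\<in>C. q x)"
  unfolding sublinear_def
proof (intro conjI ballI allI impI)
  fix x y assume xy: "x \<in> vcarrier V" "y \<in> vcarrier V"
  have *: "(INF q\<in>C. q (vadd V x y)) \<le> q x + r y" if qr: "q \<in> C" "r \<in> C" for q r
  proof -
    have "\<exists>s\<in>C. s x \<le> q x \<and> s y \<le> r y"
      using chain[OF qr] xy qr by (metis order_refl)
    then obtain s where s: "s \<in> C" "s x \<le> q x" "s y \<le> r y" by blast
    have "(INF q\<in>C. q (vadd V x y)) \<le> s (vadd V x y)"
      using s xy by (intro cINF_lower bdd) (auto simp: add_closed)
    also have "\<dots> \<le> s x + s y" using C(2)[OF s(1)] xy by (rule sublinear_add)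
    finally show ?thesis using s by simp
  qed
  have "(INF q\<in>C. q (vadd V x y)) - r y \<le> (INF q\<in>C. q x)" if "r \<in> C" for r
    using * that C(1) by (intro cINF_greatest) (auto simp: algebra_simps)
  then have "(INF q\<in>C. q (vadd V x y)) - (INF q\<in>C. q x) \<le> (INF q\<in>C. q y)"
    using C(1) by (intro cINF_greatest) (auto simp: algebra_simps)
  then show "(INF q\<in>C. q (vadd V x y)) \<le> (INF q\<in>C. q x) + (INF q\<in>C. q y)" by simp
next
  fix x c assume x: "x \<in> vcarrier V" and c: "0 \<le> (c::real)"
  have "(INF q\<in>C. q (vscale V c x)) = (INF q\<in>C. c * q x)"
    using C(2) x c by (intro INF_cong) (auto simp: sublinear_scale)
  also have "\<dots> = c * (INF q\<in>C. q x)"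
  proof (cases "c = 0")
    case True
    then show ?thesis using C(1) by simp
  next
    case False
    then have c: "0 < c" using c by simp
    show ?thesis
    proof (rule antisym)
      obtain m where m: "\<And>q. q \<in> C \<Longrightarrow> m \<le> q x"
        using bdd[OF x] by (auto simp: bdd_below_def)
      have b: "bdd_below ((\<lambda>q. c * q x) ` C)"
        using m c by (intro bdd_belowI2[where m = "c * m"] mult_left_mono) auto
      have "(INF q\<in>C. c * q x) / c \<le> q x" if "q \<in> C" for q
        using cINF_lower[OF b that] c by (simp add: pos_divide_le_eq mult.commute)
      then have "(INF q\<in>C. c * q x) / c \<le> (INF q\<in>C. q x)"
        using C(1) by (intro cINF_greatest) auto
      then show "(INF q\<in>C. c * q x) \<le> c * (INF q\<in>C. q x)" using c by (simp add: field_simps)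
      show "c * (INF q\<in>C. q x) \<le> (INF q\<in>C. c * q x)"
        using C(1) c by (intro cINF_greatest mult_left_mono cINF_lower bdd x) auto
    qed
  qed
  finally show "(INF q\<in>C. q (vscale V c x)) = c * (INF q\<in>C. q x)" .
qed

text \<open>Zorn's lemma yields a minimal sublinear functional below p. Shifting it in any direction
  cannot lower it further, which makes it odd.\<close>

theorem linear_below_sublinear:
  assumes p: "sublinear p"
  obtains q where "linear_functional q" "\<And>x. x \<in> vcarrier V \<Longrightarrow> q x \<le> p x"
proof -
  \<comment> \<open>Values off the carrier are fixed to be 0, so that functionals agreeing on the
    carrier are equal and the order on \<open>A\<close> is antisymmetric.\<close>
  define A where "A = {q. sublinear q \<and> (\<forall>x\<in>vcarrier V. q x \<le> p x) \<and> (\<forall>x. x \<notin> vcarrier V \<longrightarrow> q x = 0)}"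
  \<comment> \<open>The order is reversed: \<open>P q r\<close> puts r below q, so upper bounds of
    chains are pointwise infima and maximal elements are minimal functionals.\<close>
  define P where "P q r \<longleftrightarrow> (\<forall>x\<in>vcarrier V. r x \<le> q x)" for q r :: "'v \<Rightarrow> real"
  define ext where "ext q x = (if x \<in> vcarrier V then q x else 0)" for q :: "'v \<Rightarrow> real" and x
  have ext: "sublinear (ext q)" if "sublinear q" for q
    using that by (auto simp: sublinear_def ext_def add_closed scale_closed)
  have A_eq: "q = r" if "q \<in> A" "r \<in> A" "P q r" "P r q" for q r
  proof
    show "q x = r x" for x
      using that by (cases "x \<in> vcarrier V") (auto simp: A_def P_def intro: antisym)
  qed
  \<comment> \<open>A lower bound common to all of \<open>A\<close> keeps the infima over chains
    finite.\<close>
  have lower: "- p (vscale V (-1) x) \<le> q x" if "q \<in> A" "x \<in> vcarrier V" for q x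
  proof -
    have "sublinear q" "q (vscale V (-1) x) \<le> p (vscale V (-1) x)"
      using that scale_closed[of x "-1"] by (auto simp: A_def)
    then show ?thesis using sublinear_neg_lower[of q x] that(2) by linarith
  qed
  have "\<exists>m\<in>A. \<forall>a\<in>A. P m a \<longrightarrow> a = m"
  proof (rule predicate_Zorn)
    show "partial_order_on A (relation_of P A)"
    proof (rule partial_order_on_relation_ofI)
      fix q r s show "\<lbrakk>q \<in> A; r \<in> A; s \<in> A; P q r; P r s\<rbrakk> \<Longrightarrow> P q s"
        unfolding P_def by (meson order_trans)
    qed (auto simp: P_def intro: A_eq[unfolded P_def])
  next
    fix C assume "C \<in> Chains (relation_of P A)"
    then have CA: "C \<subseteq> A" and chain: "\<And>q r. \<lbrakk>q \<in> C; r \<in> C\<rbrakk> \<Longrightarrow> P q r \<or> P r q"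
      by (auto simp: Chains_def relation_of_def)
    show "\<exists>u\<in>A. \<forall>a\<in>C. P a u"
    proof (cases "C = {}")
      case True
      then show ?thesis using p by (auto simp: A_def intro!: exI[of _ "ext p"] ext simp: ext_def)
    next
      case False
      define u where "u = ext (\<lambda>x. INF q\<in>C. q x)"
      have bdd: "bdd_below ((\<lambda>q. q x) ` C)" if "x \<in> vcarrier V" for x
        using lower CA that by (intro bdd_belowI2[where m = "- p (vscale V (-1) x)"]) auto
      have "sublinear u"
        unfolding u_def using CA chain bdd False
        by (intro ext sublinear_Inf_chain) (auto simp: A_def P_def)
      moreover have low: "u x \<le> q x" if "q \<in> C" "x \<in> vcarrier V" for q x
        using that bdd by (auto simp: u_def ext_def intro!: cINF_lower)
      moreover have "u x \<le> p x" if "x \<in> vcarrier V" for x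
        using False CA low[OF _ that] that unfolding A_def by (force intro: order_trans)
      ultimately show ?thesis
        by (intro bexI[of _ u]) (auto simp: A_def P_def u_def ext_def)
    qed
  qed
  then obtain m where m: "m \<in> A" and min: "\<And>a. \<lbrakk>a \<in> A; P m a\<rbrakk> \<Longrightarrow> a = m" by blast
  have sm: "sublinear m" using m by (simp add: A_def)
  have "m (vscale V (-1) x) = - m x" if x: "x \<in> vcarrier V" for x
  proof -
    have "ext (shift m x) \<in> A"
      using m shift_le[OF sm x] ext[OF sublinear_shift[OF sm x]] unfolding A_def ext_def
      by (auto intro: order_trans)
    moreover have "P m (ext (shift m x))"
      using shift_le[OF sm x] by (simp add: P_def ext_def)
    ultimately have "ext (shift m x) = m" by (rule min)
    then have "m (vscale V (-1) x) = shift m x (vscale V (-1) x)"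
      using x by (metis ext_def scale_closed)
    also have "\<dots> \<le> - m x" using shift_neg[OF sm x] .
    finally show ?thesis using sublinear_neg_lower[OF sm x] by simp
  qed
  then have "linear_functional m" using sm by (intro sublinear_odd_imp_linear)
  then show thesis using m that by (simp add: A_def)
qed

text \<open>The functional is taken below the norm shifted in direction x rather than below the norm
  itself. This forces q(-x) \<le> -||x||, hence q(x) = ||x||, without extending a functional from
  the line through x.\<close>

corollary norming_functional:
  assumes x: "x \<in> vcarrier V"
  obtains q where "linear_functional q" "\<And>y. y \<in> vcarrier V \<Longrightarrow> \<bar>q y\<bar> \<le> vnorm V y" "q x = vnorm V x"
proof -
  have sn: "sublinear (vnorm V)" by (simp add: sublinear_def norm_triangle norm_scale)
  obtain q where q: "linear_functional q" "\<And>y. y \<in> vcarrier V \<Longrightarrow> q y \<le> shift (vnorm V) x y"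
    using linear_below_sublinear[OF sublinear_shift[OF sn x]] by blast
  have up: "q y \<le> vnorm V y" if "y \<in> vcarrier V" for y
    using q(2)[OF that] shift_le[OF sn x that] by simp
  have neg: "q (vscale V (-1) y) = - q y" if "y \<in> vcarrier V" for y
    using q(1) that unfolding linear_functional_def by force
  have "\<bar>q y\<bar> \<le> vnorm V y" if "y \<in> vcarrier V" for y
    using up[OF that] up[OF scale_closed[OF that], of "-1"] neg[OF that] that
    by (simp add: norm_scale)
  moreover have "- q x \<le> - vnorm V x"
    using q(2)[OF scale_closed[OF x], of "-1"] shift_neg[OF sn x] neg[OF x] by simp
  ultimately show thesis using that q(1) up[OF x] by force
qed

text \<open>Norming functionals of the points of a countable dense set suffice. If they all vanish
  at x \<noteq> 0 and d is closer to x than ||x||/2, then ||d|| = |q(x - d)| \<le> ||x - d|| <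
  ||x||/2 for the functional q of d, against the triangle inequality.\<close>

corollary separating_functionals:
  assumes "separable_space (vtopology V)"
  obtains Q where "countable Q"
    "\<And>q. q \<in> Q \<Longrightarrow> linear_functional q"
    "\<And>q x. \<lbrakk>q \<in> Q; x \<in> vcarrier V\<rbrakk> \<Longrightarrow> \<bar>q x\<bar> \<le> vnorm V x"
    "\<And>x. \<lbrakk>x \<in> vcarrier V; \<And>q. q \<in> Q \<Longrightarrow> q x = 0\<rbrakk> \<Longrightarrow> x = vzero V"
proof -
  obtain C where C: "countable C" "C \<subseteq> vcarrier V" "mtopology closure_of C = vcarrier V"
    using assms by (auto simp: separable_space_def vtopology_def)
  have "\<forall>d\<in>C. \<exists>q. linear_functional q \<and> (\<forall>y\<in>vcarrier V. \<bar>q y\<bar> \<le> vnorm V y) \<and> q d = vnorm V d"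
    using C(2) norming_functional by (metis subsetD)
  then obtain \<Phi> where \<Phi>: "\<And>d. d \<in> C \<Longrightarrow> linear_functional (\<Phi> d)"
    "\<And>d y. \<lbrakk>d \<in> C; y \<in> vcarrier V\<rbrakk> \<Longrightarrow> \<bar>\<Phi> d y\<bar> \<le> vnorm V y" "\<And>d. d \<in> C \<Longrightarrow> \<Phi> d d = vnorm V d"
    by metis
  show thesis
  proof (rule that[of "\<Phi> ` C"])
    fix x assume x: "x \<in> vcarrier V" and 0: "\<And>q. q \<in> \<Phi> ` C \<Longrightarrow> q x = 0"
    show "x = vzero V"
    proof (rule ccontr)
      assume "x \<noteq> vzero V"
      then have "0 < vnorm V x / 2"
        using x norm_eq_zero[OF x] norm_nonneg[OF x] by simp
      moreover have "x \<in> mtopology closure_of C" using C(3) x by simp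
      ultimately obtain d where d: "d \<in> C" "vdist V x d < vnorm V x / 2"
        unfolding metric_closure_of in_mball by blast
      have dV: "d \<in> vcarrier V" using d C by blast
      let ?e = "vadd V x (vscale V (-1) d)"
      have e: "?e \<in> vcarrier V" "vnorm V ?e < vnorm V x / 2"
        using d(2) x dV by (auto simp: vdist_def add_closed scale_closed)
      have "\<Phi> d ?e = - vnorm V d"
        using \<Phi>(1)[OF d(1)] \<Phi>(3)[OF d(1)] 0 d(1) x dV
        by (simp add: linear_functional_def scale_closed)
      then have "vnorm V d \<le> vnorm V ?e" using \<Phi>(2)[OF d(1) e(1)] by simp
      moreover have "x = vadd V ?e d"
        using x dV by (metis add_assoc add_commute add_neg add_zero scale_closed)
      then have "vnorm V x \<le> vnorm V ?e + vnorm V d"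
        using norm_triangle[OF e(1) dV] by simp
      ultimately show False using e(2) by simp
    qed
  qed (use C \<Phi> in auto)
qed

end

subsection \<open>Densities and conditional probabilities\<close>

text \<open>Radon-Nikodym for a signed set function. Adding the indefinite integral \<open>W\<close>
  of the weight makes it nonnegative, and l + W \<le> 2 W gives both continuity at the empty set and
  absolute continuity. If D is the density of l + W, then D - w is the density of l.\<close>

lemma (in finite_measure) obtain_density:
  fixes l :: "'a set \<Rightarrow> real"
  assumes w: "integrable M w"
    and add: "\<And>A B. \<lbrakk>A \<in> sets M; B \<in> sets M; A \<inter> B = {}\<rbrakk> \<Longrightarrow> l (A \<union> B) = l A + l B"
    and bound: "\<And>A. A \<in> sets M \<Longrightarrow> \<bar>l A\<bar> \<le> (\<integral>x. indicator A x * w x \<partial>M)"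
  obtains k where "integrable M k" "\<And>A. A \<in> sets M \<Longrightarrow> l A = (\<integral>x. indicator A x * k x \<partial>M)"
proof -
  define W where "W A = (\<integral>x. indicator A x * w x \<partial>M)" for A
  have ind: "integrable M (\<lambda>x. indicator A x * w x)" if "A \<in> sets M" for A
    using integrable_mult_indicator[OF that w] by simp
  have Wadd: "W (A \<union> B) = W A + W B" if "A \<in> sets M" "B \<in> sets M" "A \<inter> B = {}" for A B
  proof -
    have "W (A \<union> B) = (\<integral>x. indicator A x * w x + indicator B x * w x \<partial>M)"
      unfolding W_def using that by (intro Bochner_Integration.integral_cong) (auto simp: indicator_def)
    then show ?thesis using that by (simp add: W_def ind)
  qed
  define \<nu> where "\<nu> A = ennreal (l A + W A)" for A
  have pos: "0 \<le> l A + W A" "l A + W A \<le> 2 * W A" if "A \<in> sets M" for A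
    using bound[OF that] by (auto simp: W_def)
  define N where "N = measure_of (space M) (sets M) \<nu>"
  have "positive (sets M) \<nu>"
    using bound[of "{}"] by (simp add: positive_def \<nu>_def W_def)
  \<comment> \<open>Finite additivity is upgraded by continuity along sequences decreasing to the
    empty set, where \<open>W\<close> tends to 0 by dominated convergence.\<close>
  moreover have "countably_additive (sets M) \<nu>"
  proof (rule sets.empty_continuous_imp_countably_additive)
    show "additive (sets M) \<nu>"
      unfolding additive_def
    proof (intro ballI impI)
      fix A B assume AB: "A \<in> sets M" "B \<in> sets M" "A \<inter> B = {}"
      then have "l (A \<union> B) + W (A \<union> B) = (l A + W A) + (l B + W B)"
        by (simp add: add Wadd)
      then show "\<nu> (A \<union> B) = \<nu> A + \<nu> B"
        using pos AB by (simp add: \<nu>_def ennreal_plus)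
    qed
    fix A :: "nat \<Rightarrow> 'a set" assume A: "range A \<subseteq> sets M" "decseq A" "(\<Inter>i. A i) = {}"
    have "(\<lambda>i. W (A i)) \<longlonglongrightarrow> (\<integral>x. 0 \<partial>M)"
      unfolding W_def
    proof (rule integral_dominated_convergence)
      show "AE x in M. (\<lambda>i. indicator (A i) x * w x) \<longlonglongrightarrow> 0"
      proof (rule AE_I2)
        fix x
        have "(\<lambda>i. indicator (A i) x * w x) \<longlonglongrightarrow> indicator (\<Inter>i. A i) x * w x"
          using A by (intro tendsto_mult tendsto_const LIMSEQ_indicator_decseq)
        then show "(\<lambda>i. indicator (A i) x * w x) \<longlonglongrightarrow> 0" using A(3) by simp
      qed
      show "AE x in M. norm (indicator (A i) x * w x) \<le> norm (w x)" for i
        by (auto simp: indicator_def)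
    qed (use A w ind in \<open>auto intro!: borel_measurable_integrable\<close>)
    then have W0: "(\<lambda>i. 2 * W (A i)) \<longlonglongrightarrow> 0"
      using tendsto_mult_left[of _ "0::real" sequentially 2] by simp
    have "(\<lambda>i. l (A i) + W (A i)) \<longlonglongrightarrow> 0"
      by (rule tendsto_sandwich[OF _ _ tendsto_const W0]) (use A pos in auto)
    then show "(\<lambda>i. \<nu> (A i)) \<longlonglongrightarrow> 0"
      unfolding \<nu>_def using tendsto_ennrealI by fastforce
  qed (use \<open>positive (sets M) \<nu>\<close> in \<open>auto simp: \<nu>_def\<close>)
  ultimately have emN: "emeasure N A = \<nu> A" if "A \<in> sets M" for A
    unfolding N_def using that by (intro emeasure_measure_of_sigma sets.sigma_algebra_axioms)
  have sN: "sets N = sets M" by (simp add: N_def)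
  have fN: "finite_measure N"
    by (rule finite_measureI)
      (use sets_eq_imp_space_eq[OF sN] in \<open>simp add: emN \<nu>_def\<close>)
  have ac: "absolutely_continuous M N"
    unfolding absolutely_continuous_def
  proof
    fix A assume A: "A \<in> null_sets M"
    then have "W A = 0"
      unfolding W_def using AE_not_in[OF A]
      by (intro integral_eq_zero_AE) (auto simp: indicator_def elim!: eventually_mono)
    then show "A \<in> null_sets N"
      using A pos[of A] by (auto simp: null_sets_def sN emN \<nu>_def)
  qed
  obtain D where D: "D \<in> borel_measurable M" "AE x in M. RN_deriv M N x = ennreal (D x)"
    "\<And>x. 0 \<le> D x"
    using real_RN_deriv[OF fN ac sN] by blast
  have "density M (\<lambda>x. ennreal (D x)) = N"
    using density_cong[OF _ _ D(2)] D(1) density_RN_deriv[OF ac sN] by simp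
  then have nn: "ennreal (l A + W A) = (\<integral>\<^sup>+x. ennreal (indicator A x * D x) \<partial>M)"
    if "A \<in> sets M" for A
    using emeasure_density[of "\<lambda>x. ennreal (D x)" M A] that D(1) emN[OF that]
    by (simp add: \<nu>_def ennreal_mult'' mult.commute ennreal_indicator D(3))
  have eq: "integrable M (\<lambda>x. indicator A x * D x) \<and> (\<integral>x. indicator A x * D x \<partial>M) = l A + W A"
    if "A \<in> sets M" for A
    using nn[OF that] pos[OF that] D that by (subst (asm) eq_commute, subst (asm) nn_integral_eq_integrable) auto
  have "integrable M (\<lambda>x. indicator (space M) x * D x)" using eq by blast
  then have Dint: "integrable M D"
    by (rule Bochner_Integration.integrable_cong[THEN iffD1, rotated -1]) auto
  show thesis
  proof (rule that[of "\<lambda>x. D x - w x"])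
    fix A assume A: "A \<in> sets M"
    show "l A = (\<integral>x. indicator A x * (D x - w x) \<partial>M)"
      using eq[OF A] ind[OF A] by (simp add: right_diff_distrib W_def)
  qed (use Dint w in auto)
qed

text \<open>Exhaustion, with maximality meant in measure. Here s(c) is the supremum of the measures
  of members above c; each set of an increasing sequence comes within 1/(n+1) of the supremum for
  its predecessor, so nothing above the union is larger in measure.\<close>

lemma (in finite_measure) obtain_maximal_set:
  assumes C: "C \<subseteq> sets M" "C \<noteq> {}"
    and UN: "\<And>A. \<lbrakk>range A \<subseteq> C; incseq A\<rbrakk> \<Longrightarrow> (\<Union>n::nat. A n) \<in> C"
  obtains c where "c \<in> C" "\<And>A. \<lbrakk>A \<in> C; c \<subseteq> A\<rbrakk> \<Longrightarrow> measure M A = measure M c"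
proof -
  define s where "s c = (SUP A\<in>{A\<in>C. c \<subseteq> A}. measure M A)" for c
  have bdd: "bdd_above (measure M ` X)" for X
    by (intro bdd_aboveI2[of _ _ "measure M (space M)"] bounded_measure)
  have "\<exists>c. \<forall>n. c n \<in> C \<and> (c n \<subseteq> c (Suc n) \<and> s (c n) - inverse (Suc n) < measure M (c (Suc n)))"
  proof (rule dependent_nat_choice)
    fix c and n :: nat assume c: "c \<in> C"
    have "s c - inverse (Suc n) < s c" by simp
    then have "\<exists>A\<in>{A\<in>C. c \<subseteq> A}. s c - inverse (Suc n) < measure M A"
      unfolding s_def using c by (subst (asm) less_cSUP_iff) (auto intro: bdd)
    then show "\<exists>A. A \<in> C \<and> c \<subseteq> A \<and> s c - inverse (Suc n) < measure M A" by blast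
  qed (use C in auto)
  then obtain c where c: "\<And>n. c n \<in> C" "\<And>n. c n \<subseteq> c (Suc n)"
    "\<And>n. s (c n) - inverse (Suc n) < measure M (c (Suc n))" by blast
  have U: "(\<Union>n. c n) \<in> C"
    using c by (intro UN incseq_SucI) auto
  show thesis
  proof (rule that[OF U])
    fix A assume A: "A \<in> C" "(\<Union>n. c n) \<subseteq> A"
    have "measure M A \<le> measure M (\<Union>n. c n) + inverse (Suc n)" for n
    proof -
      have "measure M A \<le> s (c n)"
        unfolding s_def using A by (intro cSUP_upper bdd) auto
      moreover have "measure M (c (Suc n)) \<le> measure M (\<Union>n. c n)"
        using C(1) U by (intro finite_measure_mono) auto
      ultimately show ?thesis using c(3)[of n] by linarith
    qed
    moreover have "(\<lambda>n. measure M (\<Union>n. c n) + inverse (Suc n)) \<longlonglongrightarrow> measure M (\<Union>n. c n) + 0"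
      by (intro tendsto_add tendsto_const LIMSEQ_inverse_real_of_nat)
    ultimately have "measure M A \<le> measure M (\<Union>n. c n)"
      by (intro LIMSEQ_le_const[of _ _ "measure M A"]) auto
    moreover have "measure M (\<Union>n. c n) \<le> measure M A"
      using A C by (intro finite_measure_mono) auto
    ultimately show "measure M A = measure M (\<Union>n. c n)" by simp
  qed
qed

section \<open>Conditional probabilities and relative atomlessness\<close>

context finite_measure_subalgebra
begin

text \<open>Maharam's notion of being atomless over \<open>F\<close>. When \<open>F\<close> contains
  only the empty set and the whole space, it is ordinary atomlessness.\<close>

definition relatively_atomless :: bool where
  "relatively_atomless \<longleftrightarrow> (\<forall>S\<in>sets M. 0 < measure M S \<longrightarrow>
     (\<exists>A\<in>sets M. A \<subseteq> S \<and> (\<forall>G\<in>sets F. \<not> (AE x in M. x \<in> S \<longrightarrow> (x \<in> A \<longleftrightarrow> x \<in> G)))))"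

abbreviation cprob :: "'a set \<Rightarrow> 'a \<Rightarrow> real" where
  "cprob A \<equiv> real_cond_exp M F (indicator A)"

lemma sets_F: "G \<in> sets F \<Longrightarrow> G \<in> sets M" and space_F: "space F = space M"
  using subalg by (auto simp: subalgebra_def)

lemma integrable_indicator': "A \<in> sets M \<Longrightarrow> integrable M (indicator A :: 'a \<Rightarrow> real)"
  by (intro integrable_real_indicator) (simp_all add: less_top[symmetric])

lemma cprob_Int:
  assumes "A \<in> sets M" "G \<in> sets F"
  shows "AE x in M. cprob (A \<inter> G) x = indicator G x * cprob A x"
proof -
  have "(indicator (A \<inter> G) :: 'a \<Rightarrow> real) = (\<lambda>x. indicator G x * indicator A x)"
    by (auto simp: indicator_def)
  moreover have "AE x in M. real_cond_exp M F (\<lambda>x. indicator G x * indicator A x) x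
      = indicator G x * cprob A x"
    using assms sets_F[OF assms(2)] integrable_indicator'[of "A \<inter> G"]
    by (intro real_cond_exp_mult) (auto simp: indicator_inter_arith[symmetric] Int_commute)
  ultimately show ?thesis by simp
qed

lemma cprob_nonneg: "A \<in> sets M \<Longrightarrow> AE x in M. 0 \<le> cprob A x"
  by (rule real_cond_exp_pos) auto

lemma cprob_Un:
  assumes "A \<in> sets M" "B \<in> sets M" "A \<inter> B = {}"
  shows "AE x in M. cprob (A \<union> B) x = cprob A x + cprob B x"
proof -
  have "(indicator (A \<union> B) :: 'a \<Rightarrow> real) = (\<lambda>x. indicator A x + indicator B x)"
    using assms(3) by (auto simp: indicator_def fun_eq_iff)
  then show ?thesis
    using real_cond_exp_add[OF integrable_indicator'[OF assms(1)] integrable_indicator'[OF assms(2)]]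
    by simp
qed

lemma cprob_integral:
  assumes "A \<in> sets M" "G \<in> sets F"
  shows "integrable M (\<lambda>x. indicator G x * cprob A x)"
    and "(\<integral>x. indicator G x * cprob A x \<partial>M) = measure M (A \<inter> G)"
proof -
  have *: "integrable M (\<lambda>x. indicator G x * indicator A x :: real)"
    using integrable_indicator'[of "A \<inter> G"] assms sets_F
    by (simp add: indicator_inter_arith[symmetric] Int_commute)
  show "integrable M (\<lambda>x. indicator G x * cprob A x)"
    by (rule real_cond_exp_intg) (use * assms in auto)
  have "(\<integral>x. indicator G x * cprob A x \<partial>M) = (\<integral>x. indicator G x * indicator A x \<partial>M)"
    by (rule real_cond_exp_intg) (use * assms in auto)
  also have "\<dots> = (\<integral>x. indicator (A \<inter> G) x \<partial>M)"
    by (simp add: indicator_inter_arith[symmetric] Int_commute)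
  also have "\<dots> = measure M (A \<inter> G)"
    using assms sets_F by (simp add: Int_absorb2 sets.sets_into_space)
  finally show "(\<integral>x. indicator G x * cprob A x \<partial>M) = measure M (A \<inter> G)" .
qed

text \<open>The integrated form on the right passes to increasing unions by continuity of the
  measure. To recover the pointwise bound, integrate the excess of \<open>cprob A\<close> over u on
  the set where it is positive: a nonnegative function with integral at most 0 vanishes almost
  everywhere.\<close>

lemma cprob_le_iff:
  assumes A: "A \<in> sets M"
  shows "(AE x in M. cprob A x \<le> u) \<longleftrightarrow> (\<forall>G\<in>sets F. measure M (A \<inter> G) \<le> u * measure M G)"
proof
  assume le: "AE x in M. cprob A x \<le> u"
  show "\<forall>G\<in>sets F. measure M (A \<inter> G) \<le> u * measure M G"
  proof
    fix G assume G: "G \<in> sets F"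
    have "measure M (A \<inter> G) \<le> (\<integral>x. indicator G x * u \<partial>M)"
      unfolding cprob_integral(2)[OF A G, symmetric]
      using le G sets_F
      by (intro integral_mono_AE cprob_integral(1) A G integrable_mult_left integrable_indicator')
        (auto simp: indicator_def)
    also have "\<dots> = u * measure M G"
      using sets_F[OF G] by (simp add: Int_absorb2 sets.sets_into_space)
    finally show "measure M (A \<inter> G) \<le> u * measure M G" .
  qed
next
  assume *: "\<forall>G\<in>sets F. measure M (A \<inter> G) \<le> u * measure M G"
  define G where "G = {x \<in> space F. u < cprob A x}"
  have G: "G \<in> sets F" unfolding G_def by measurable
  define f where "f x = indicator G x * cprob A x - indicator G x * u" for x
  have f: "integrable M f"
    unfolding f_def using cprob_integral(1)[OF A G] integrable_indicator'[OF sets_F[OF G]]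
    by (intro Bochner_Integration.integrable_diff integrable_mult_left) auto
  have "(\<integral>x. f x \<partial>M) = measure M (A \<inter> G) - u * measure M G"
    unfolding f_def
    using cprob_integral[OF A G] integrable_indicator'[OF sets_F[OF G]] sets_F[OF G]
    by (simp add: Int_absorb2 sets.sets_into_space)
  then have "(\<integral>x. f x \<partial>M) \<le> 0" using * G by simp
  moreover have f0: "0 \<le> f x" for x
    by (auto simp: f_def G_def indicator_def)
  ultimately have "(\<integral>x. f x \<partial>M) = 0"
    by (meson antisym Bochner_Integration.integral_nonneg)
  then have "AE x in M. f x = 0"
    using integral_nonneg_eq_0_iff_AE[OF f] f0 by simp
  then show "AE x in M. cprob A x \<le> u"
    using AE_space by eventually_elim (auto simp: f_def G_def indicator_def space_F split: if_splits)
qed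

text \<open>
  Split \<open>S\<close> into \<open>A\<close> and \<open>S - A\<close>, and keep of each half the part where its conditional probability is the
  smaller one. If both parts were null, \<open>A\<close> would be the trace on \<open>S\<close> of a set of \<open>F\<close>.
\<close>

lemma halve_cprob:
  assumes ra: relatively_atomless and S: "S \<in> sets M" "0 < measure M S"
  obtains A where "A \<in> sets M" "A \<subseteq> S" "0 < measure M A" "AE x in M. cprob A x \<le> cprob S x / 2"
proof -
  obtain A where A: "A \<in> sets M" "A \<subseteq> S"
    "\<And>G. G \<in> sets F \<Longrightarrow> \<not> (AE x in M. x \<in> S \<longrightarrow> (x \<in> A \<longleftrightarrow> x \<in> G))"
    using bspec[OF ra[unfolded relatively_atomless_def] S(1)] S(2) by blast
  define G where "G = {x \<in> space F. cprob S x / 2 < cprob A x}"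
  have G: "G \<in> sets F" unfolding G_def by measurable
  have cG: "space M - G \<in> sets F" using G space_F by (metis sets.compl_sets)
  have SA: "S - A \<in> sets M" using S A by auto
  have sum: "AE x in M. cprob S x = cprob A x + cprob (S - A) x"
    using cprob_Un[OF A(1) SA] A(2) by (simp add: Un_absorb1)
  let ?A1 = "A \<inter> (space M - G)" and ?A2 = "(S - A) \<inter> G"
  have "AE x in M. cprob ?A1 x \<le> cprob S x / 2"
    using cprob_Int[OF A(1) cG] cprob_nonneg[OF S(1)] AE_space
    by eventually_elim (auto simp: indicator_def G_def space_F)
  moreover have "AE x in M. cprob ?A2 x \<le> cprob S x / 2"
    using cprob_Int[OF SA G] cprob_nonneg[OF S(1)] sum AE_space
    by eventually_elim (auto simp: indicator_def G_def space_F)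
  moreover have "0 < measure M ?A1 \<or> 0 < measure M ?A2"
  proof (rule ccontr)
    assume "\<not> ?thesis"
    then have "measure M ?A1 = 0" "measure M ?A2 = 0"
      by (simp_all add: not_less measure_le_0_iff)
    then have n: "?A1 \<in> null_sets M" "?A2 \<in> null_sets M"
      using A(1) SA sets_F[OF G] sets_F[OF cG] by (auto simp: null_sets_def emeasure_eq_measure)
    have "AE x in M. x \<in> S \<longrightarrow> (x \<in> A \<longleftrightarrow> x \<in> G)"
      using AE_not_in[OF n(1)] AE_not_in[OF n(2)] AE_space by eventually_elim auto
    then show False using A(3)[OF G] by simp
  qed
  ultimately show thesis
    using that[of ?A1] that[of ?A2] A(1,2) SA sets_F[OF G] sets_F[OF cG] by blast
qed

text \<open>Repeated halving, starting from the bound 1 for \<open>S\<close> itself.\<close>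

lemma small_cprob:
  assumes ra: relatively_atomless and S: "S \<in> sets M" "0 < measure M S"
  shows "\<exists>A\<in>sets M. A \<subseteq> S \<and> 0 < measure M A \<and> (AE x in M. cprob A x \<le> (1 / 2) ^ n)"
proof (induction n)
  case 0
  have "AE x in M. cprob S x \<le> 1"
    by (rule real_cond_exp_le_c) (use S integrable_indicator' in \<open>auto simp: indicator_def\<close>)
  then show ?case using S by auto
next
  case (Suc n)
  then obtain A where A: "A \<in> sets M" "A \<subseteq> S" "0 < measure M A" "AE x in M. cprob A x \<le> (1 / 2) ^ n"
    by blast
  obtain B where B: "B \<in> sets M" "B \<subseteq> A" "0 < measure M B" "AE x in M. cprob B x \<le> cprob A x / 2"
    using halve_cprob[OF ra A(1,3)] by blast
  have "AE x in M. cprob B x \<le> (1 / 2) ^ Suc n"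
    using A(4) B(4) by eventually_elim simp
  then show ?case using A(2) B by blast
qed

text \<open>
  Maharam's lemma. A maximal set with conditional probability at most \<open>u\<close> leaves no room: wherever it
  falls short of \<open>u\<close>, its complement contains a non-null set of small conditional probability.
\<close>

theorem obtain_constant_cprob:
  assumes ra: relatively_atomless and u: "0 \<le> u" "u \<le> 1"
  obtains A where "A \<in> sets M" "AE x in M. cprob A x = u"
proof -
  define C where "C = {A \<in> sets M. AE x in M. cprob A x \<le> u}"
  have C_eq: "C = {A \<in> sets M. \<forall>G\<in>sets F. measure M (A \<inter> G) \<le> u * measure M G}"
    unfolding C_def using cprob_le_iff by blast
  have C: "C \<subseteq> sets M" by (auto simp: C_def)
  have "{} \<in> C" using u by (simp add: C_eq)
  then have ne: "C \<noteq> {}" by blast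
  have UN: "(\<Union>n. A n) \<in> C" if A: "range A \<subseteq> C" "incseq A" for A :: "nat \<Rightarrow> 'a set"
  proof -
    have "measure M ((\<Union>n. A n) \<inter> G) \<le> u * measure M G" if G: "G \<in> sets F" for G
    proof (rule LIMSEQ_le_const2)
      have "(\<lambda>n. measure M (A n \<inter> G)) \<longlonglongrightarrow> measure M (\<Union>n. A n \<inter> G)"
        using A sets_F[OF G]
        by (intro finite_Lim_measure_incseq) (auto simp: C_eq intro!: incseq_SucI dest: incseq_SucD)
      then show "(\<lambda>n. measure M (A n \<inter> G)) \<longlonglongrightarrow> measure M ((\<Union>n. A n) \<inter> G)"
        by simp
      show "\<exists>N. \<forall>n\<ge>N. measure M (A n \<inter> G) \<le> u * measure M G"
        using A G by (auto simp: C_eq)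
    qed
    then show ?thesis using A by (auto simp: C_eq)
  qed
  obtain c where c: "c \<in> C" and max: "\<And>A. \<lbrakk>A \<in> C; c \<subseteq> A\<rbrakk> \<Longrightarrow> measure M A = measure M c"
    using obtain_maximal_set[OF C ne UN] by metis
  have cM: "c \<in> sets M" and le: "AE x in M. cprob c x \<le> u" using c by (auto simp: C_def)
  \<comment> \<open>If this fails, the set \<open>G\<close> where c falls short of u by at least
    \<open>(1 / 2) ^ n\<close> is non-null.\<close>
  have "AE x in M. u - (1 / 2) ^ n < cprob c x" for n
  proof (rule ccontr)
    assume nAE: "\<not> ?thesis"
    let ?e = "(1 / 2 :: real) ^ n"
    define G where "G = {x \<in> space F. cprob c x \<le> u - ?e}"
    have G: "G \<in> sets F" unfolding G_def by measurable
    have GM: "G \<in> sets M" using sets_F[OF G] .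
    have "measure M G \<noteq> 0"
    proof
      assume "measure M G = 0"
      then have "G \<in> null_sets M" using GM by (auto simp: null_sets_def emeasure_eq_measure)
      from AE_not_in[OF this] AE_space have "AE x in M. u - ?e < cprob c x"
        by eventually_elim (auto simp: G_def space_F)
      with nAE show False by simp
    qed
    then have G0: "0 < measure M G" by (simp add: zero_less_measure_iff)
    \<comment> \<open>Integrating the deficit shows that c does not fill \<open>G\<close>; the
      inequality is strict even for u = 1.\<close>
    have "measure M (c \<inter> G) = (\<integral>x. indicator G x * cprob c x \<partial>M)"
      by (rule cprob_integral(2)[OF cM G, symmetric])
    also have "\<dots> \<le> (\<integral>x. indicator G x * (u - ?e) \<partial>M)"
      by (intro integral_mono cprob_integral(1) cM G integrable_mult_left integrable_indicator' GM)
        (auto simp: indicator_def G_def)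
    also have "\<dots> = (u - ?e) * measure M G"
      using GM by (simp add: Int_absorb2 sets.sets_into_space)
    also have "\<dots> < 1 * measure M G"
    proof (intro mult_strict_right_mono G0)
      have "0 < ?e" by simp
      then show "u - ?e < 1" using u by linarith
    qed
    finally have "measure M (c \<inter> G) < measure M G" by simp
    moreover have "measure M (G - c) = measure M G - measure M (G \<inter> c)"
      using cM GM by (simp add: finite_measure_Diff')
    ultimately have "0 < measure M (G - c)" by (simp add: Int_commute)
    then obtain A where A: "A \<in> sets M" "A \<subseteq> G - c" "0 < measure M A" "AE x in M. cprob A x \<le> ?e"
      using small_cprob[OF ra, of "G - c" n] cM GM by blast
    have "A \<inter> G = A" using A by auto
    \<comment> \<open>Since A lies in \<open>G\<close>, its conditional probability vanishes off
      \<open>G\<close>. On \<open>G\<close> it is at most the deficit of c, so the union of c and A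
      still belongs to \<open>C\<close>.\<close>
    then have AG: "AE x in M. cprob A x = indicator G x * cprob A x"
      using cprob_Int[OF A(1) G] by simp
    have dis: "c \<inter> A = {}" using A by auto
    have "AE x in M. cprob (c \<union> A) x \<le> u"
      using cprob_Un[OF cM A(1) dis] A(4) AG le AE_space
      by eventually_elim (auto simp: G_def space_F indicator_def split: if_splits)
    then have "measure M (c \<union> A) = measure M c"
      using cM A(1) by (intro max) (auto simp: C_def)
    then show False
      using finite_measure_Union[OF cM A(1) dis] A(3) by simp
  qed
  then have "AE x in M. \<forall>n. u - (1 / 2) ^ n < cprob c x" by (simp add: AE_all_countable)
  with le have "AE x in M. cprob c x = u"
  proof eventually_elim
    case (elim x)
    have "(\<lambda>n. u - (1 / 2) ^ n) \<longlonglongrightarrow> u - 0"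
      by (intro tendsto_diff tendsto_const LIMSEQ_realpow_zero) auto
    then have "u \<le> cprob c x"
      using elim(2) by (intro LIMSEQ_le_const2[of _ u]) (auto intro: less_imp_le)
    then show ?case using elim(1) by simp
  qed
  then show thesis using that cM by blast
qed

text \<open>Because k is measurable for \<open>F\<close>, the indicator of A may be replaced under
  the integral by its conditional expectation, which is the constant u.\<close>

lemma integral_constant_cprob:
  assumes A: "A \<in> sets M" "AE x in M. cprob A x = u"
    and k: "integrable M k" "k \<in> borel_measurable F"
  shows "(\<integral>x. indicator A x * k x \<partial>M) = u * (\<integral>x. k x \<partial>M)"
proof -
  have "integrable M (\<lambda>x. k x * indicator A x)"
    using integrable_mult_indicator[OF A(1) k(1)] by (simp add: mult.commute)
  then have "(\<integral>x. k x * cprob A x \<partial>M) = (\<integral>x. k x * indicator A x \<partial>M)"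
    using A(1) k(2) by (intro real_cond_exp_intg) auto
  moreover have "(\<integral>x. k x * cprob A x \<partial>M) = (\<integral>x. k x * u \<partial>M)"
    using A(2) measurable_from_subalg[OF subalg k(2)]
    by (intro integral_cong_AE) (auto elim: eventually_mono)
  ultimately show ?thesis by (simp add: mult.commute)
qed

end

subsection \<open>Approximation and completeness in \<open>L\<^sup>1\<close>\<close>

lemma L1_carrierE:
  assumes "X \<in> vcarrier (L1 N)"
  obtains f where "integrable N f" "X = L1_class N f"
  using assms by (auto simp: L1_carrier)

lemma L1_carrierI: "integrable N f \<Longrightarrow> L1_class N f \<in> vcarrier (L1 N)"
  by (simp add: L1_carrier)

lemma L1_dist:
  assumes "integrable N f" "integrable N g"
  shows "vdist (L1 N) (L1_class N f) (L1_class N g) = (\<integral>x. norm (f x - g x) \<partial>N)"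
  using assms by (simp add: vdist_def L1_carrierI L1_scale L1_add L1_norm)

text \<open>Closure in L^1, expressed with functions instead of classes. Integrability of f is built
  in because the integral of a non-integrable function is 0 by convention; that of the members of D
  is a separate assumption where it matters.\<close>

definition L1_approx :: "'a measure \<Rightarrow> ('a \<Rightarrow> 'e) set \<Rightarrow> ('a \<Rightarrow> 'e::{banach, second_countable_topology}) \<Rightarrow> bool" where
  "L1_approx N D f \<longleftrightarrow> integrable N f \<and> (\<forall>\<epsilon>>0. \<exists>d\<in>D. (\<integral>x. norm (f x - d x) \<partial>N) < \<epsilon>)"

lemma L1_approx_integrable: "L1_approx N D f \<Longrightarrow> integrable N f"
  and L1_approxD: "\<lbrakk>L1_approx N D f; 0 < \<epsilon>\<rbrakk> \<Longrightarrow> \<exists>d\<in>D. (\<integral>x. norm (f x - d x) \<partial>N) < \<epsilon>"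
  by (auto simp: L1_approx_def)

text \<open>Moves separability from classes to functions: a countable dense set of classes is
  replaced by one representative of each.\<close>

lemma separable_L1_iff:
  "separable_space (vtopology (L1 N :: ('a \<Rightarrow> 'e::{banach, second_countable_topology}) set nvs)) \<longleftrightarrow>
    (\<exists>D :: ('a \<Rightarrow> 'e) set. countable D \<and> (\<forall>d\<in>D. integrable N d) \<and> (\<forall>f. integrable N f \<longrightarrow> L1_approx N D f))"
  (is "?lhs \<longleftrightarrow> ?rhs")
proof -
  let ?L = "L1 N :: ('a \<Rightarrow> 'e) set nvs"
  interpret L: normed_vs ?L by (rule normed_vs_L1)
  have dense_iff: "L.mtopology closure_of (L1_class N ` D) = vcarrier ?L \<longleftrightarrow> (\<forall>f. integrable N f \<longrightarrow> L1_approx N D f)"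
    if D: "\<forall>d\<in>D. integrable N d" for D :: "('a \<Rightarrow> 'e) set"
  proof -
    have "L.mtopology closure_of (L1_class N ` D) = vcarrier ?L \<longleftrightarrow>
        (\<forall>X\<in>vcarrier ?L. \<forall>r>0. \<exists>d\<in>D. vdist ?L X (L1_class N d) < r)"
      using D by (auto simp: L.metric_closure_of L1_carrierI)
    also have "\<dots> \<longleftrightarrow> (\<forall>f. integrable N f \<longrightarrow> (\<forall>r>0. \<exists>d\<in>D. vdist ?L (L1_class N f) (L1_class N d) < r))"
      by (auto simp: L1_carrier)
    also have "\<dots> \<longleftrightarrow> (\<forall>f. integrable N f \<longrightarrow> L1_approx N D f)"
      unfolding L1_approx_def by (metis D L1_dist)
    finally show ?thesis .
  qed
  show ?thesis
  proof
    assume ?lhs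
    then obtain C where C: "countable C" "C \<subseteq> vcarrier ?L" "L.mtopology closure_of C = vcarrier ?L"
      by (auto simp: separable_space_def vtopology_def)
    have "\<forall>X\<in>C. \<exists>f. integrable N f \<and> X = L1_class N f"
      using C(2) by (auto simp: L1_carrier)
    then obtain r where r: "\<And>X. X \<in> C \<Longrightarrow> integrable N (r X) \<and> X = L1_class N (r X)"
      by metis
    then have "L1_class N ` r ` C = C" by (auto simp: image_image cong: image_cong_simp)
    then show ?rhs
      using C r dense_iff[of "r ` C"] by (intro exI[of _ "r ` C"]) auto
  next
    assume ?rhs
    then obtain D :: "('a \<Rightarrow> 'e) set" where D: "countable D" "\<forall>d\<in>D. integrable N d"
      "\<forall>f. integrable N f \<longrightarrow> L1_approx N D f" by blast
    then show ?lhs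
      using dense_iff[OF D(2)]
      by (auto simp: separable_space_def vtopology_def L1_carrierI intro!: exI[of _ "L1_class N ` D"])
  qed
qed

lemma L1_approx_add:
  assumes D: "\<And>d. d \<in> D \<Longrightarrow> integrable N d" "\<And>d e. \<lbrakk>d \<in> D; e \<in> D\<rbrakk> \<Longrightarrow> (\<lambda>x. d x + e x) \<in> D"
    and f: "L1_approx N D f" and g: "L1_approx N D g"
  shows "L1_approx N D (\<lambda>x. f x + g x)"
  unfolding L1_approx_def
proof (intro conjI allI impI)
  note int = L1_approx_integrable[OF f] L1_approx_integrable[OF g]
  show "integrable N (\<lambda>x. f x + g x)" using int by simp
  fix \<epsilon> :: real assume "0 < \<epsilon>"
  then obtain d e where d: "d \<in> D" "(\<integral>x. norm (f x - d x) \<partial>N) < \<epsilon> / 2"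
    and e: "e \<in> D" "(\<integral>x. norm (g x - e x) \<partial>N) < \<epsilon> / 2"
    using L1_approxD[OF f, of "\<epsilon> / 2"] L1_approxD[OF g, of "\<epsilon> / 2"] by auto
  have "(\<integral>x. norm (f x + g x - (d x + e x)) \<partial>N) \<le> (\<integral>x. norm (f x - d x) + norm (g x - e x) \<partial>N)"
    using int D(1)[OF d(1)] D(1)[OF e(1)] by (intro integral_mono) (auto intro: norm_diff_triangle_ineq)
  also have "\<dots> < \<epsilon>"
    using int D(1)[OF d(1)] D(1)[OF e(1)] d(2) e(2) by simp
  finally show "\<exists>h\<in>D. (\<integral>x. norm (f x + g x - h x) \<partial>N) < \<epsilon>"
    using D(2)[OF d(1) e(1)] by (intro bexI[of _ "\<lambda>x. d x + e x"])
qed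

lemma L1_approx_uminus:
  assumes "\<And>d. d \<in> D \<Longrightarrow> (\<lambda>x. - d x) \<in> D" "L1_approx N D f"
  shows "L1_approx N D (\<lambda>x. - f x)"
  unfolding L1_approx_def
proof (intro conjI allI impI)
  show "integrable N (\<lambda>x. - f x)" using L1_approx_integrable[OF assms(2)] by simp
  fix \<epsilon> :: real assume "0 < \<epsilon>"
  then obtain d where d: "d \<in> D" "(\<integral>x. norm (f x - d x) \<partial>N) < \<epsilon>"
    using L1_approxD[OF assms(2)] by blast
  have "(\<integral>x. norm (- f x - (- d x)) \<partial>N) = (\<integral>x. norm (f x - d x) \<partial>N)"
    by (intro Bochner_Integration.integral_cong refl) (simp add: norm_minus_commute)
  then show "\<exists>h\<in>D. (\<integral>x. norm (- f x - h x) \<partial>N) < \<epsilon>"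
    using d assms(1)[OF d(1)] by (intro bexI[of _ "\<lambda>x. - d x"]) auto
qed

lemma L1_approx_trans:
  assumes f: "integrable N f" and D: "\<And>d. d \<in> D \<Longrightarrow> integrable N d"
    and g: "\<And>\<epsilon>. 0 < \<epsilon> \<Longrightarrow> \<exists>g. L1_approx N D g \<and> (\<integral>x. norm (f x - g x) \<partial>N) < \<epsilon>"
  shows "L1_approx N D f"
  unfolding L1_approx_def
proof (intro conjI allI impI f)
  fix \<epsilon> :: real assume "0 < \<epsilon>"
  then obtain g where g: "L1_approx N D g" "(\<integral>x. norm (f x - g x) \<partial>N) < \<epsilon> / 2"
    using g[of "\<epsilon> / 2"] by auto
  obtain d where d: "d \<in> D" "(\<integral>x. norm (g x - d x) \<partial>N) < \<epsilon> / 2"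
    using L1_approxD[OF g(1), of "\<epsilon> / 2"] \<open>0 < \<epsilon>\<close> by auto
  note int = f L1_approx_integrable[OF g(1)] D[OF d(1)]
  have "(\<integral>x. norm (f x - d x) \<partial>N) \<le> (\<integral>x. norm (f x - g x) + norm (g x - d x) \<partial>N)"
    using int norm_triangle_ineq[of "f x - g x" "g x - d x" for x] by (intro integral_mono) auto
  also have "\<dots> < \<epsilon>" using int g(2) d(2) by simp
  finally show "\<exists>d\<in>D. (\<integral>x. norm (f x - d x) \<partial>N) < \<epsilon>" using d(1) by blast
qed

text \<open>The factor 2 matches the limit case of the induction rule for integrable functions; it
  makes \<open>3 * norm (f x)\<close> a dominating function for the differences.\<close>

lemma L1_approx_dominated_lim:
  assumes D: "\<And>d. d \<in> D \<Longrightarrow> integrable N d" and f: "integrable N f"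
    and s: "\<And>i. L1_approx N D (s i)"
      "\<And>x. x \<in> space N \<Longrightarrow> (\<lambda>i. s i x) \<longlonglongrightarrow> f x"
      "\<And>i x. x \<in> space N \<Longrightarrow> norm (s i x) \<le> 2 * norm (f x)"
  shows "L1_approx N D f"
proof (rule L1_approx_trans[OF f D])
  note [measurable] = borel_measurable_integrable[OF f]
    borel_measurable_integrable[OF L1_approx_integrable[OF s(1)]]
  have "(\<lambda>i. \<integral>x. norm (f x - s i x) \<partial>N) \<longlonglongrightarrow> (\<integral>x. 0 \<partial>N)"
  proof (rule integral_dominated_convergence)
    show "integrable N (\<lambda>x. 3 * norm (f x))" using f by simp
    show "AE x in N. (\<lambda>i. norm (f x - s i x)) \<longlonglongrightarrow> 0"
    proof (rule AE_I2)
      fix x assume "x \<in> space N"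
      then have "(\<lambda>i. norm (f x - s i x)) \<longlonglongrightarrow> norm (f x - f x)"
        using s(2) by (intro tendsto_intros)
      then show "(\<lambda>i. norm (f x - s i x)) \<longlonglongrightarrow> 0" by simp
    qed
    show "AE x in N. norm (norm (f x - s i x)) \<le> 3 * norm (f x)" for i
    proof (rule AE_I2)
      fix x assume "x \<in> space N"
      then show "norm (norm (f x - s i x)) \<le> 3 * norm (f x)"
        using s(3)[of x i] norm_triangle_ineq4[of "f x" "s i x"] by simp
    qed
  qed auto
  then have lim: "(\<lambda>i. \<integral>x. norm (f x - s i x) \<partial>N) \<longlonglongrightarrow> 0" by simp
  fix \<epsilon> :: real assume "0 < \<epsilon>"
  then obtain i where "(\<integral>x. norm (f x - s i x) \<partial>N) < \<epsilon>"
    using order_tendstoD(2)[OF lim] by (meson eventually_happens sequentially_bot)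
  then show "\<exists>g. L1_approx N D g \<and> (\<integral>x. norm (f x - g x) \<partial>N) < \<epsilon>" using s(1) by blast
qed

lemma L1_approx_all:
  assumes D: "\<And>d. d \<in> D \<Longrightarrow> integrable N d" "\<And>d e. \<lbrakk>d \<in> D; e \<in> D\<rbrakk> \<Longrightarrow> (\<lambda>x. d x + e x) \<in> D"
    and base: "\<And>A c. \<lbrakk>A \<in> sets N; emeasure N A < \<infinity>\<rbrakk> \<Longrightarrow> L1_approx N D (\<lambda>x. indicator A x *\<^sub>R c)"
    and f: "integrable N f"
  shows "L1_approx N D f"
  using f
proof induction
  case (lim f s)
  show ?case by (rule L1_approx_dominated_lim[OF D(1), where s = s]) (use lim in auto)
qed (auto intro: base L1_approx_add[OF D])

text \<open>Sums are indexed by lists, so that addition is concatenation and countability follows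
  from that of the set of lists.\<close>

definition step_sums :: "('a \<Rightarrow> real) set \<Rightarrow> 'e::real_vector set \<Rightarrow> ('a \<Rightarrow> 'e) set" where
  "step_sums C X = (\<lambda>xs \<omega>. \<Sum>(d, x)\<leftarrow>xs. d \<omega> *\<^sub>R x) ` lists (C \<times> X)"

lemma countable_step_sums: "\<lbrakk>countable C; countable X\<rbrakk> \<Longrightarrow> countable (step_sums C X)"
  unfolding step_sums_def by (intro countable_image countable_lists countable_SIGMA) auto

lemma step_sums_add:
  assumes "d \<in> step_sums C X" "e \<in> step_sums C X"
  shows "(\<lambda>\<omega>. d \<omega> + e \<omega>) \<in> step_sums C X"
proof -
  obtain xs ys where *: "xs \<in> lists (C \<times> X)" "d = (\<lambda>\<omega>. \<Sum>(d, x)\<leftarrow>xs. d \<omega> *\<^sub>R x)"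
    "ys \<in> lists (C \<times> X)" "e = (\<lambda>\<omega>. \<Sum>(d, x)\<leftarrow>ys. d \<omega> *\<^sub>R x)"
    using assms unfolding step_sums_def by blast
  then show ?thesis
    unfolding step_sums_def by (intro image_eqI[of _ _ "xs @ ys"]) auto
qed

lemma step_sums_single: "\<lbrakk>d \<in> C; x \<in> X\<rbrakk> \<Longrightarrow> (\<lambda>\<omega>. d \<omega> *\<^sub>R x) \<in> step_sums C X"
  unfolding step_sums_def by (intro image_eqI[of _ _ "[(d, x)]"]) auto

lemma step_sums_uminus:
  assumes X: "\<And>x. x \<in> X \<Longrightarrow> - x \<in> X" and d: "d \<in> step_sums C X"
  shows "(\<lambda>\<omega>. - d \<omega>) \<in> step_sums C X"
proof -
  obtain xs where xs: "xs \<in> lists (C \<times> X)" "d = (\<lambda>\<omega>. \<Sum>(d, x)\<leftarrow>xs. d \<omega> *\<^sub>R x)"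
    using d unfolding step_sums_def by blast
  have "(\<lambda>\<omega>. - d \<omega>) = (\<lambda>\<omega>. \<Sum>(d, x)\<leftarrow>map (apsnd uminus) xs. d \<omega> *\<^sub>R x)"
    unfolding xs(2) by (induction xs) (auto simp: fun_eq_iff)
  moreover have "map (apsnd uminus) xs \<in> lists (C \<times> X)"
    using xs(1) X by (auto simp: in_lists_conv_set)
  ultimately show ?thesis unfolding step_sums_def by blast
qed

lemma integrable_step_sums:
  fixes X :: "'e::{banach, second_countable_topology} set"
  assumes C: "\<And>c. c \<in> C \<Longrightarrow> integrable N c" and d: "d \<in> step_sums C X"
  shows "integrable N d"
proof -
  obtain xs where xs: "xs \<in> lists (C \<times> X)" "d = (\<lambda>\<omega>. \<Sum>(d, x)\<leftarrow>xs. d \<omega> *\<^sub>R x)"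
    using d unfolding step_sums_def by blast
  from xs(1) show ?thesis
    unfolding xs(2) by (induction xs) (auto intro!: Bochner_Integration.integrable_add integrable_scaleR_left C)
qed

text \<open>Approximating real indicators is enough for every value space: if d is near the
  indicator of A and x is near c, then d x is near the indicator times c. This serves real functions
  in one direction of the theorem and vector-valued ones in the other.\<close>

lemma separable_L1_if_indicators:
  assumes C: "countable C" "\<And>c. c \<in> C \<Longrightarrow> integrable N c"
    and ind: "\<And>A. \<lbrakk>A \<in> sets N; emeasure N A < \<infinity>\<rbrakk> \<Longrightarrow> L1_approx N C (indicator A :: 'a \<Rightarrow> real)"
  shows "separable_space (vtopology (L1 N :: ('a \<Rightarrow> 'e::{banach, second_countable_topology}) set nvs))"
proof -
  obtain X :: "'e set" where X: "countable X" "\<And>U. \<lbrakk>open U; U \<noteq> {}\<rbrakk> \<Longrightarrow> \<exists>x\<in>X. x \<in> U"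
    by (rule countable_dense_setE) blast
  let ?D = "step_sums C X"
  note Dint = integrable_step_sums[OF C(2)]
  have base: "L1_approx N ?D (\<lambda>\<omega>. indicator A \<omega> *\<^sub>R c)" if A: "A \<in> sets N" "emeasure N A < \<infinity>" for A c
    unfolding L1_approx_def
  proof (intro conjI allI impI)
    have iA: "integrable N (indicator A :: 'a \<Rightarrow> real)" using A by simp
    then show "integrable N (\<lambda>\<omega>. indicator A \<omega> *\<^sub>R c)" by simp
    fix \<epsilon> :: real assume \<epsilon>: "0 < \<epsilon>"
    let ?m = "measure N A"
    \<comment> \<open>x is chosen before d, since the tolerance for d depends on
      \<open>norm x\<close>. The added 1 keeps both denominators positive when A is null or x =
      0.\<close>
    have "0 < \<epsilon> / (2 * (?m + 1))"
      using \<epsilon> by (auto intro!: divide_pos_pos add_nonneg_pos)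
    then obtain x where x: "x \<in> X" "dist c x < \<epsilon> / (2 * (?m + 1))"
      using X(2)[of "ball c (\<epsilon> / (2 * (?m + 1)))"] by auto
    have "0 < \<epsilon> / (2 * (norm x + 1))"
      using \<epsilon> by (auto intro!: divide_pos_pos add_nonneg_pos)
    then obtain d where d: "d \<in> C" "(\<integral>\<omega>. norm (indicator A \<omega> - d \<omega>) \<partial>N) < \<epsilon> / (2 * (norm x + 1))"
      using L1_approxD[OF ind[OF A]] by blast
    note id = C(2)[OF d(1)]
    have "(\<integral>\<omega>. norm (indicator A \<omega> *\<^sub>R c - d \<omega> *\<^sub>R x) \<partial>N)
        \<le> (\<integral>\<omega>. indicator A \<omega> * norm (c - x) + norm (indicator A \<omega> - d \<omega>) * norm x \<partial>N)"
    proof (intro integral_mono)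
      fix \<omega>
      have "indicator A \<omega> *\<^sub>R c - d \<omega> *\<^sub>R x = indicator A \<omega> *\<^sub>R (c - x) + (indicator A \<omega> - d \<omega>) *\<^sub>R x"
        by (simp add: algebra_simps)
      then show "norm (indicator A \<omega> *\<^sub>R c - d \<omega> *\<^sub>R x)
          \<le> indicator A \<omega> * norm (c - x) + norm (indicator A \<omega> - d \<omega>) * norm x"
        using norm_triangle_ineq[of "indicator A \<omega> *\<^sub>R (c - x)" "(indicator A \<omega> - d \<omega>) *\<^sub>R x"] by simp
    qed (use iA id in auto)
    also have "\<dots> = ?m * norm (c - x) + (\<integral>\<omega>. norm (indicator A \<omega> - d \<omega>) \<partial>N) * norm x"
      using iA id A by (simp add: Int_absorb2 sets.sets_into_space)
    also have "\<dots> < \<epsilon> / 2 + \<epsilon> / 2"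
    proof (rule add_less_le_mono)
      have "?m * norm (c - x) \<le> ?m * (\<epsilon> / (2 * (?m + 1)))"
        using x(2) by (intro mult_left_mono) (auto simp: dist_norm)
      also have "\<dots> < \<epsilon> / 2"
        using \<epsilon> measure_nonneg[of N A] by (simp add: field_simps add_pos_nonneg)
      finally show "?m * norm (c - x) < \<epsilon> / 2" .
      have "(\<integral>\<omega>. norm (indicator A \<omega> - d \<omega>) \<partial>N) * norm x \<le> \<epsilon> / (2 * (norm x + 1)) * norm x"
        using d(2) by (intro mult_right_mono) auto
      also have "\<dots> \<le> \<epsilon> / 2"
        using \<epsilon> norm_ge_zero[of x] by (simp add: field_simps add_pos_nonneg)
      finally show "(\<integral>\<omega>. norm (indicator A \<omega> - d \<omega>) \<partial>N) * norm x \<le> \<epsilon> / 2" .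
    qed
    finally show "\<exists>d\<in>?D. (\<integral>\<omega>. norm (indicator A \<omega> *\<^sub>R c - d \<omega>) \<partial>N) < \<epsilon>"
      using step_sums_single[OF d(1) x(1)] by (intro bexI[of _ "\<lambda>\<omega>. d \<omega> *\<^sub>R x"]) auto
  qed
  have "L1_approx N ?D f" if f: "integrable N f" for f
    by (rule L1_approx_all[OF _ _ _ f]) (blast intro: Dint step_sums_add base)+
  then show ?thesis
    unfolding separable_L1_iff
    using countable_step_sums[OF C(1) X(1)] Dint by blast
qed

text \<open>Dynkin's pi-lambda argument: the sets whose indicators can be approximated are closed
  under complements and disjoint countable unions, for which coefficients 1 and -1 are enough.
  \<Omega> may differ from \<open>space N\<close>, so that N can be a restriction while
  \<open>P\<close> lives on the full space.\<close>

lemma L1_approx_sigma_sets: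
  assumes N: "finite_measure N"
    and P: "Int_stable P" "P \<subseteq> Pow \<Omega>" "\<Omega> \<in> P"
    and sets: "\<And>A. A \<in> sigma_sets \<Omega> P \<Longrightarrow> A \<inter> space N \<in> sets N"
    and A: "A \<in> sigma_sets \<Omega> P"
  shows "L1_approx N (step_sums (indicator ` P) {1, -1}) (indicator A :: 'a \<Rightarrow> real)"
proof -
  interpret N: finite_measure N by fact
  let ?C = "indicator ` P :: ('a \<Rightarrow> real) set"
  let ?D = "step_sums ?C {1, -1 :: real}"
  have int: "integrable N (indicator A :: 'a \<Rightarrow> real)" if "A \<in> sigma_sets \<Omega> P" for A
    using sets[OF that] by (simp add: integrable_indicator_iff less_top[symmetric])
  have D: "d \<in> ?D \<Longrightarrow> integrable N d" for d
    by (rule integrable_step_sums[of ?C]) (auto intro: int)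
  have add: "L1_approx N ?D (\<lambda>x. f x + g x)" if "L1_approx N ?D f" "L1_approx N ?D g" for f g
    using that by (intro L1_approx_add D step_sums_add)
  have neg: "L1_approx N ?D (\<lambda>x. - f x)" if "L1_approx N ?D f" for f
    using that by (intro L1_approx_uminus step_sums_uminus) auto
  have gen: "L1_approx N ?D (indicator A)" if "A \<in> P" for A
    unfolding L1_approx_def
  proof (intro conjI allI impI)
    fix \<epsilon> :: real assume "0 < \<epsilon>"
    moreover have "(\<lambda>\<omega>. indicator A \<omega> *\<^sub>R 1 :: real) \<in> ?D"
      using that by (intro step_sums_single) auto
    ultimately show "\<exists>d\<in>?D. (\<integral>x. norm (indicator A x - d x) \<partial>N) < \<epsilon>"
      by (intro bexI[of _ "\<lambda>\<omega>. indicator A \<omega> *\<^sub>R 1"]) auto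
  qed (use that int in auto)
  \<comment> \<open>The empty set need not belong to \<open>P\<close>, so its indicator is written
    as a difference.\<close>
  have "(\<lambda>x. indicator \<Omega> x + - indicator \<Omega> x :: real) = indicator {}"
    by (auto simp: fun_eq_iff)
  then have empty_approx: "L1_approx N ?D (indicator {})"
    using add[OF gen[OF P(3)] neg[OF gen[OF P(3)]]] by simp
  from P(1,2) A show ?thesis
  proof (induction rule: sigma_sets_induct_disjoint)
    case (basic A)
    then show ?case by (rule gen)
  next
    case empty
    show ?case by (rule empty_approx)
  next
    case (compl A)
    then have "A \<subseteq> \<Omega>" using sigma_sets_into_sp[OF P(2)] by blast
    then have "(\<lambda>x. indicator \<Omega> x + - indicator A x :: real) = indicator (\<Omega> - A)"
      by (auto simp: fun_eq_iff indicator_def)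
    then show ?case
      using add[OF gen[OF P(3)] neg[OF compl.IH]] by simp
  next
    case (union A)
    have dis: "A i \<inter> A j = {}" if "i \<noteq> j" for i j
      using union.hyps that by (auto simp: disjoint_family_on_def)
    have eq: "indicator (\<Union>i<n. A i) = (\<lambda>x. \<Sum>i<n. indicator (A i) x :: real)" for n
      using dis by (subst indicator_UN_disjoint[symmetric]) (auto simp: disjoint_family_on_def)
    have fin: "L1_approx N ?D (indicator (\<Union>i<n. A i))" for n
    proof (induction n)
      case 0
      show ?case using empty_approx by (simp only: lessThan_0 image_empty Union_empty)
    next
      case (Suc n)
      have "indicator (\<Union>i<Suc n. A i) = (\<lambda>x. indicator (\<Union>i<n. A i) x + indicator (A n) x :: real)"
        unfolding eq by auto
      then show ?case using add[OF Suc.IH union.IH[of n]] by simp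
    qed
    show ?case
    proof (rule L1_approx_dominated_lim[OF D, where s = "\<lambda>n. indicator (\<Union>i<n. A i)"])
      show "integrable N (indicator (\<Union>i. A i) :: 'a \<Rightarrow> real)"
        using union.hyps by (intro int sigma_sets.Union) auto
      show "(\<lambda>n. indicator (\<Union>i<n. A i) x :: real) \<longlonglongrightarrow> indicator (\<Union>i. A i) x" for x
        by (rule LIMSEQ_indicator_UN)
      show "norm (indicator (\<Union>i<n. A i) x :: real) \<le> 2 * norm (indicator (\<Union>i. A i) x :: real)" for n x
        by (auto simp: indicator_def)
    qed (assumption, rule fin)
  qed
qed

text \<open>Riesz-Fischer: along a fast subsequence the increments have summable norms, so the
  telescoping series converges almost everywhere, and in L^1 by dominated convergence. A Cauchy
  sequence with a convergent subsequence converges.\<close>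

proposition mcomplete_L1:
  "Metric_space.mcomplete (vcarrier (L1 N)) (vdist (L1 N :: ('a \<Rightarrow> 'e::{banach, second_countable_topology}) set nvs))"
proof -
  let ?L = "L1 N :: ('a \<Rightarrow> 'e) set nvs"
  interpret L: normed_vs ?L by (rule normed_vs_L1)
  show ?thesis
    unfolding L.mcomplete_def
  proof (intro allI impI)
    fix \<sigma> assume \<sigma>: "L.MCauchy \<sigma>"
    then have "\<sigma> n \<in> vcarrier ?L" for n by (auto simp: L.MCauchy_def)
    then have "\<forall>n. \<exists>f. integrable N f \<and> \<sigma> n = L1_class N f" by (metis L1_carrierE)
    then obtain f where f: "\<And>n. integrable N (f n)" "\<And>n. \<sigma> n = L1_class N (f n)" by metis
    have "\<exists>r. \<forall>n. (\<forall>m\<ge>r n. \<forall>m'\<ge>r n. vdist ?L (\<sigma> m) (\<sigma> m') < (1 / 2) ^ n) \<and> r n < r (Suc n)"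
    proof (rule dependent_nat_choice)
      have ex: "\<exists>k. \<forall>m\<ge>k. \<forall>m'\<ge>k. vdist ?L (\<sigma> m) (\<sigma> m') < (1 / 2) ^ n" for n
      proof -
        have "(0::real) < (1 / 2) ^ n" by simp
        moreover have "\<forall>\<epsilon>>0. \<exists>k. \<forall>m m'. k \<le> m \<longrightarrow> k \<le> m' \<longrightarrow> vdist ?L (\<sigma> m) (\<sigma> m') < \<epsilon>"
          using \<sigma> by (simp add: L.MCauchy_def)
        ultimately show ?thesis by meson
      qed
      then show "\<exists>k. \<forall>m\<ge>k. \<forall>m'\<ge>k. vdist ?L (\<sigma> m) (\<sigma> m') < (1 / 2) ^ 0" .
      fix k n :: nat
      obtain k' where "\<forall>m\<ge>k'. \<forall>m'\<ge>k'. vdist ?L (\<sigma> m) (\<sigma> m') < (1 / 2) ^ Suc n" using ex by blast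
      then show "\<exists>k'. (\<forall>m\<ge>k'. \<forall>m'\<ge>k'. vdist ?L (\<sigma> m) (\<sigma> m') < (1 / 2) ^ Suc n) \<and> k < k'"
        by (intro exI[of _ "max k' (Suc k)"]) auto
    qed
    then obtain r where r: "\<And>n m m'. \<lbrakk>r n \<le> m; r n \<le> m'\<rbrakk> \<Longrightarrow> vdist ?L (\<sigma> m) (\<sigma> m') < (1 / 2) ^ n"
      "\<And>n. r n < r (Suc n)" by blast
    have mono: "strict_mono r" using r(2) by (rule strict_monoI_Suc)
    define g where "g n x = f (r (Suc n)) x - f (r n) x" for n x
    have g: "integrable N (g n)" for n unfolding g_def using f(1) by simp
    have g_le: "(\<integral>x. norm (g n x) \<partial>N) \<le> (1 / 2) ^ n" for n
      using r(1)[of n "r (Suc n)" "r n"] r(2)[of n] f by (simp add: L1_dist g_def)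
    have sums: "summable (\<lambda>n. \<integral>x. norm (g n x) \<partial>N)"
      by (rule summable_comparison_test'[OF summable_geometric[of "1/2"], of 0]) (use g_le in auto)
    note [measurable] = borel_measurable_integrable[OF g]
    \<comment> \<open>Exchanging sum and integral shows that the sum of the norms has finite
      integral, hence is finite almost everywhere.\<close>
    have "(\<integral>\<^sup>+x. (\<Sum>n. ennreal (norm (g n x))) \<partial>N) = (\<Sum>n. ennreal (\<integral>x. norm (g n x) \<partial>N))"
      using g by (subst nn_integral_suminf) (auto simp: nn_integral_eq_integral)
    also have "\<dots> = ennreal (\<Sum>n. \<integral>x. norm (g n x) \<partial>N)"
      by (rule suminf_ennreal_eq) (use sums summable_sums in auto)
    finally have "(\<integral>\<^sup>+x. (\<Sum>n. ennreal (norm (g n x))) \<partial>N) \<noteq> \<infinity>" by simp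
    then have "AE x in N. (\<Sum>n. ennreal (norm (g n x))) \<noteq> \<infinity>"
      by (rule nn_integral_noteq_infinite[rotated]) measurable
    then have AEs: "AE x in N. summable (\<lambda>n. norm (g n x))"
      by eventually_elim (auto intro: summable_suminf_not_top)
    have int_norm: "integrable N (\<lambda>x. \<Sum>n. norm (g n x))"
      by (rule integrable_suminf) (use g sums AEs in auto)
    have int_sum: "integrable N (\<lambda>x. \<Sum>n. g n x)"
      by (rule integrable_suminf) (use g sums AEs in auto)
    define h where "h x = f (r 0) x + (\<Sum>n. g n x)" for x
    have h: "integrable N h" unfolding h_def using f(1) int_sum by simp
    note [measurable] = borel_measurable_integrable[OF h] borel_measurable_integrable[OF f(1)]
    have tele: "f (r n) x - f (r 0) x = (\<Sum>i<n. g i x)" for n x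
      unfolding g_def by (subst sum_lessThan_telescope) simp
    have "(\<lambda>n. \<integral>x. norm (f (r n) x - h x) \<partial>N) \<longlonglongrightarrow> (\<integral>x. 0 \<partial>N)"
    proof (rule integral_dominated_convergence)
      show "integrable N (\<lambda>x. 2 * (\<Sum>n. norm (g n x)))" using int_norm by simp
      show "AE x in N. (\<lambda>n. norm (f (r n) x - h x)) \<longlonglongrightarrow> 0"
        using AEs
      proof eventually_elim
        case (elim x)
        have "(\<lambda>n. (\<Sum>i<n. g i x) - (\<Sum>i. g i x)) \<longlonglongrightarrow> (\<Sum>i. g i x) - (\<Sum>i. g i x)"
          by (intro tendsto_diff tendsto_const summable_LIMSEQ summable_norm_cancel[OF elim])
        then have "(\<lambda>n. (\<Sum>i<n. g i x) - (\<Sum>i. g i x)) \<longlonglongrightarrow> 0" by simp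
        moreover have "f (r n) x - h x = (\<Sum>i<n. g i x) - (\<Sum>i. g i x)" for n
          using tele[of n x] by (simp add: h_def algebra_simps)
        ultimately show ?case by (simp add: tendsto_norm_zero)
      qed
      show "AE x in N. norm (norm (f (r n) x - h x)) \<le> 2 * (\<Sum>n. norm (g n x))" for n
        using AEs
      proof eventually_elim
        case (elim x)
        have "f (r n) x - h x = (\<Sum>i<n. g i x) - (\<Sum>i. g i x)"
          using tele[of n x] by (simp add: h_def algebra_simps)
        then have "norm (f (r n) x - h x) \<le> norm (\<Sum>i<n. g i x) + norm (\<Sum>i. g i x)"
          by (simp add: norm_triangle_ineq4)
        also have "norm (\<Sum>i<n. g i x) \<le> (\<Sum>i. norm (g i x))"
          using norm_sum[of "\<lambda>i. g i x" "{..<n}"] sum_le_suminf[OF elim, of "{..<n}"] by simp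
        also have "norm (\<Sum>i. g i x) \<le> (\<Sum>i. norm (g i x))"
          using elim by (rule summable_norm)
        finally show ?case by simp
      qed
    qed auto
    then have "(\<lambda>n. vdist ?L ((\<sigma> \<circ> r) n) (L1_class N h)) \<longlonglongrightarrow> 0"
      using f h by (simp add: L1_dist)
    then have "limitin L.mtopology (\<sigma> \<circ> r) (L1_class N h) sequentially"
      unfolding L.limitin_metric_dist_null using f h by (auto simp: L1_carrierI)
    then show "\<exists>X. limitin L.mtopology \<sigma> X sequentially"
      using L.MCauchy_convergent_subsequence[OF \<sigma> mono] by blast
  qed
qed

subsection \<open>Bounded operators\<close>

lemma (in normed_vs) vdist_zero: "x \<in> vcarrier V \<Longrightarrow> vdist V (vzero V) x = vnorm V x"
  using norm_scale[of x "-1"]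
  by (simp add: vdist_def zero_closed add_commute[of "vzero V"] scale_closed add_zero)

text \<open>Continuity at 0 gives a ball of radius r mapped into the unit ball; rescaling a nonzero
  x to norm r/2 yields the constant 2/r.\<close>

lemma continuous_linear_vs_bounded:
  assumes V: "normed_vs V" and W: "normed_vs W" and T: "continuous_linear_vs V W T"
  obtains B where "0 \<le> B" "\<And>x. x \<in> vcarrier V \<Longrightarrow> vnorm W (T x) \<le> B * vnorm V x"
proof -
  interpret V: normed_vs V by fact
  interpret W: normed_vs W by fact
  have T_in: "T x \<in> vcarrier W" and T_scale: "T (vscale V c x) = vscale W c (T x)"
    if "x \<in> vcarrier V" for x c
    using T that by (auto simp: continuous_linear_vs_def)
  have T0: "T (vzero V) = vzero W"
    using T_scale[OF V.zero_closed, of 0] T_in[OF V.zero_closed]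
    by (simp add: V.zero_scale[OF V.zero_closed] W.zero_scale)
  let ?U = "{x \<in> vcarrier V. T x \<in> W.mball (vzero W) 1}"
  have "continuous_map V.mtopology W.mtopology T"
    using T by (simp add: continuous_linear_vs_def vtopology_def)
  from openin_continuous_map_preimage[OF this W.openin_mball[of "vzero W" 1]]
  have "openin V.mtopology ?U" unfolding V.topspace_mtopology .
  moreover have "vzero V \<in> ?U" by (simp add: T0 V.zero_closed W.zero_closed)
  ultimately obtain r where r: "0 < r" "V.mball (vzero V) r \<subseteq> ?U"
    unfolding V.openin_mtopology by blast
  have small: "vnorm W (T x) < 1" if "x \<in> vcarrier V" "vnorm V x < r" for x
  proof -
    have "x \<in> V.mball (vzero V) r" using that by (simp add: V.zero_closed V.vdist_zero)
    then show ?thesis using r(2) by (auto simp: W.vdist_zero)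
  qed
  show thesis
  proof (rule that[of "2 / r"])
    fix x assume x: "x \<in> vcarrier V"
    show "vnorm W (T x) \<le> 2 / r * vnorm V x"
    proof (cases "vnorm V x = 0")
      case True
      then have "T x = vzero W" using x T0 V.norm_eq_zero by simp
      then show ?thesis using True W.norm_eq_zero[OF W.zero_closed] by simp
    next
      case False
      then have pos: "0 < vnorm V x" using V.norm_nonneg[OF x] by simp
      have "vnorm W (T (vscale V (r / (2 * vnorm V x)) x)) < 1"
        using x r(1) pos by (intro small V.scale_closed) (simp_all add: V.norm_scale)
      then have "r / (2 * vnorm V x) * vnorm W (T x) < 1"
        using x r(1) pos by (simp add: T_scale T_in W.norm_scale)
      then show ?thesis using r(1) pos by (simp add: field_simps)
    qed
  qed (use r in simp)
qed

lemma bounded_imp_continuous_linear_vs: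
  assumes V: "normed_vs V" and W: "normed_vs W" and T_in: "T \<in> vcarrier V \<rightarrow> vcarrier W"
    and add: "\<And>x y. \<lbrakk>x \<in> vcarrier V; y \<in> vcarrier V\<rbrakk> \<Longrightarrow> T (vadd V x y) = vadd W (T x) (T y)"
    and scale: "\<And>c x. x \<in> vcarrier V \<Longrightarrow> T (vscale V c x) = vscale W c (T x)"
    and B: "\<And>x. x \<in> vcarrier V \<Longrightarrow> vnorm W (T x) \<le> B * vnorm V x"
  shows "continuous_linear_vs V W T"
proof -
  interpret V: normed_vs V by fact
  interpret W: normed_vs W by fact
  have lip: "vdist W (T x) (T y) \<le> \<bar>B\<bar> * vdist V x y" if "x \<in> vcarrier V" "y \<in> vcarrier V" for x y
  proof -
    let ?d = "vadd V x (vscale V (-1) y)"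
    have d: "?d \<in> vcarrier V" using that by (simp add: V.add_closed V.scale_closed)
    have "vdist W (T x) (T y) = vnorm W (T ?d)"
      using that T_in by (auto simp: vdist_def add scale V.scale_closed)
    also have "\<dots> \<le> B * vnorm V ?d" using B[OF d] .
    also have "\<dots> \<le> \<bar>B\<bar> * vnorm V ?d" by (intro mult_right_mono V.norm_nonneg d) simp
    finally show ?thesis using that by (simp add: vdist_def)
  qed
  have "continuous_map V.mtopology W.mtopology T"
    unfolding W.continuous_map_to_metric
  proof (intro ballI allI impI)
    fix x and \<epsilon> :: real assume x: "x \<in> topspace V.mtopology" and \<epsilon>: "0 < \<epsilon>"
    then have xV: "x \<in> vcarrier V" by simp
    let ?\<delta> = "\<epsilon> / (\<bar>B\<bar> + 1)"
    have "T y \<in> W.mball (T x) \<epsilon>" if y: "y \<in> V.mball x ?\<delta>" for y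
    proof -
      have "vdist V x y * (\<bar>B\<bar> + 1) < \<epsilon>"
        using y by (simp add: pos_less_divide_eq)
      then have "vdist W (T x) (T y) < \<epsilon>"
        using lip[OF xV, of y] y V.nonneg[of x y]
        unfolding V.in_mball distrib_left mult.commute[of _ "\<bar>B\<bar>"] mult_1_right by linarith
      then show ?thesis using T_in xV y by auto
    qed
    moreover have "x \<in> V.mball x ?\<delta>" using xV \<epsilon> by (auto intro: divide_pos_pos)
    ultimately show "\<exists>U. openin V.mtopology U \<and> x \<in> U \<and> (\<forall>y\<in>U. T y \<in> W.mball (T x) \<epsilon>)"
      using V.openin_mball by blast
  qed
  then show ?thesis
    using T_in add scale by (simp add: continuous_linear_vs_def vtopology_def)
qed

subsection \<open>Saturated measure spaces\<close>

lemma subalgebra_sigma: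
  assumes P: "P \<subseteq> sets M"
  shows "subalgebra M (sigma (space M) P)"
proof -
  have "P \<subseteq> Pow (space M)" using P sets.sets_into_space by blast
  then show ?thesis by (simp add: subalgebra_def space_measure_of sets.sigma_sets_subset[OF P])
qed

text \<open>If on a non-null \<open>S\<close> every measurable subset agreed almost everywhere with
  a set generated by \<open>P\<close>, countably many step functions would be dense in L^1 over
  \<open>S\<close>.\<close>

lemma saturated_imp_relatively_atomless:
  assumes sat: "saturated M" and P: "countable P" "P \<subseteq> sets M"
  shows "finite_measure_subalgebra.relatively_atomless M (sigma (space M) P)"
proof (rule ccontr)
  interpret finite_measure M using sat by (simp add: saturated_def)
  let ?F = "sigma (space M) P"
  have Pow: "P \<subseteq> Pow (space M)" using P(2) sets.sets_into_space by blast
  interpret finite_measure_subalgebra M ?F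
    by unfold_locales (rule subalgebra_sigma[OF P(2)])
  assume "\<not> relatively_atomless"
  then have "\<exists>S\<in>sets M. 0 < measure M S \<and> (\<forall>A\<in>sets M. A \<subseteq> S \<longrightarrow>
      (\<exists>G\<in>sets ?F. AE x in M. x \<in> S \<longrightarrow> (x \<in> A \<longleftrightarrow> x \<in> G)))"
    by (simp add: relatively_atomless_def)
  then obtain S where S: "S \<in> sets M" "0 < measure M S"
    and H: "\<And>A. \<lbrakk>A \<in> sets M; A \<subseteq> S\<rbrakk> \<Longrightarrow> \<exists>G\<in>sets ?F. AE x in M. x \<in> S \<longrightarrow> (x \<in> A \<longleftrightarrow> x \<in> G)"
    by blast
  \<comment> \<open>Finite intersections turn \<open>P\<close> into a countable pi-system; the empty
    family contributes the whole space.\<close>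
  define Q where "Q = (\<lambda>X. space M \<inter> \<Inter>X) ` {X. finite X \<and> X \<subseteq> P}"
  have Q_sets: "Q \<subseteq> sets M"
  proof
    fix A assume "A \<in> Q"
    then obtain X where X: "finite X" "X \<subseteq> P" "A = space M \<inter> \<Inter>X" by (auto simp: Q_def)
    from X(1,2) have "space M \<inter> \<Inter>X \<in> sets M"
    proof (induction X)
      case (insert p X)
      have "space M \<inter> \<Inter>(insert p X) = p \<inter> (space M \<inter> \<Inter>X)" by auto
      then show ?case using insert P(2) by auto
    qed auto
    then show "A \<in> sets M" using X(3) by simp
  qed
  then have Q_Pow: "Q \<subseteq> Pow (space M)" using sets.sets_into_space by blast
  have "P \<subseteq> Q"
  proof
    fix p assume p: "p \<in> P"
    then have "p = space M \<inter> \<Inter>{p}" using Pow by auto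
    then show "p \<in> Q" using p unfolding Q_def by blast
  qed
  have Q_stable: "Int_stable Q"
  proof (rule Int_stableI)
    fix A B assume "A \<in> Q" "B \<in> Q"
    then obtain X Y where XY: "finite X" "X \<subseteq> P" "A = space M \<inter> \<Inter>X" "finite Y" "Y \<subseteq> P" "B = space M \<inter> \<Inter>Y"
      by (auto simp: Q_def)
    then show "A \<inter> B \<in> Q" unfolding Q_def by (intro image_eqI[of _ _ "X \<union> Y"]) auto
  qed
  have Q_space: "space M \<in> Q" unfolding Q_def by (intro image_eqI[of _ _ "{}"]) auto
  have Q_count: "countable Q"
    unfolding Q_def by (intro countable_image countable_Collect_finite_subset P(1))
  have QM: "A \<in> sets M" if "A \<in> sigma_sets (space M) Q" for A
    using sets.sigma_sets_subset[OF Q_sets] that by blast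
  define N where "N = restrict_space M S"
  have SM: "S \<inter> space M \<in> sets M" "S \<inter> space M = S"
    using S(1) sets.sets_into_space by (auto simp: Int_absorb2)
  have finN: "finite_measure N" unfolding N_def 
    by (intro finite_measure_restrict_space finite_measure_axioms) (use SM in auto)
  have Q_int: "integrable N (indicator A :: 'a \<Rightarrow> real)" if "A \<in> Q" for A
  proof -
    have "A \<inter> S \<in> sets M" using that Q_sets S(1) by auto
    then show ?thesis
      using integrable_indicator'[of "A \<inter> S"] SM
      by (simp add: N_def integrable_restrict_space indicator_inter_arith[symmetric] Int_commute)
  qed
  let ?C = "step_sums (indicator ` Q) {1, -1} :: ('a \<Rightarrow> real) set"
  have Ccount: "countable ?C" by (rule countable_step_sums) (simp_all add: Q_count)
  have Cint: "integrable N d" if "d \<in> ?C" for d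
    by (rule integrable_step_sums[OF _ that]) (use Q_int in auto)
  have appr: "L1_approx N ?C (indicator A)" if A: "A \<in> sets N" for A
  proof -
    have AM: "A \<in> sets M" "A \<subseteq> S"
      using A SM by (simp_all add: N_def sets_restrict_space_iff)
    obtain G where G: "G \<in> sets ?F" "AE x in M. x \<in> S \<longrightarrow> (x \<in> A \<longleftrightarrow> x \<in> G)"
      using H[OF AM] by blast
    have "G \<in> sigma_sets (space M) Q"
      using G(1) Pow sigma_sets_mono'[OF \<open>P \<subseteq> Q\<close>] by auto
    then have appr: "L1_approx N ?C (indicator G)"
      by (rule L1_approx_sigma_sets[OF finN Q_stable Q_Pow Q_space, rotated])
        (use QM S(1) SM in \<open>auto simp: N_def sets_restrict_space_iff space_restrict_space\<close>)
    have AE: "AE x in N. x \<in> A \<longleftrightarrow> x \<in> G"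
      unfolding N_def AE_restrict_space_iff[OF SM(1)] by (rule G(2))
    have int: "integrable N (indicator A :: 'a \<Rightarrow> real)"
      using A finN by (simp add: integrable_indicator_iff finite_measure.emeasure_finite less_top[symmetric])
    show ?thesis
    proof (rule L1_approx_trans[OF int Cint])
      fix \<epsilon> :: real assume "0 < \<epsilon>"
      moreover have "(\<integral>x. norm (indicator A x - indicator G x :: real) \<partial>N) = 0"
        using AE by (intro integral_eq_zero_AE) (auto simp: indicator_def elim!: eventually_mono)
      ultimately show "\<exists>g. L1_approx N ?C g \<and> (\<integral>x. norm (indicator A x - g x) \<partial>N) < \<epsilon>"
        using appr by (intro exI[of _ "indicator G"]) simp
    qed
  qed
  have "separable_space (vtopology (L1 N :: ('a \<Rightarrow> real) set nvs))"
    by (rule separable_L1_if_indicators[OF Ccount Cint appr])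
  then show False using sat S by (auto simp: saturated_def N_def)
qed

section \<open>Lyapunov-type convexity over a saturated space\<close>

lemma
  assumes T: "continuous_linear_vs (L1 M) F T" and f: "integrable M f"
  shows continuous_linear_L1_add: "integrable M g \<Longrightarrow>
      T (L1_class M (\<lambda>\<omega>. f \<omega> + g \<omega>)) = vadd F (T (L1_class M f)) (T (L1_class M g))"
    and continuous_linear_L1_scale:
      "T (L1_class M (\<lambda>\<omega>. c *\<^sub>R f \<omega>)) = vscale F c (T (L1_class M f))"
  using T f by (simp_all add: continuous_linear_vs_def L1_carrierI flip: L1_add L1_scale)

text \<open>The vector measure sending A to T applied to the indicator of A times h attains u times
  its total value, at a set of constant conditional probability u given the densities of its scalar
  images.\<close>

proposition saturated_obtain_set:
  fixes h :: "'a \<Rightarrow> 'e::{banach, second_countable_topology}"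
  assumes sat: "saturated M" and F: "separable_banach_vs F" and T: "continuous_linear_vs (L1 M) F T"
    and h: "integrable M h" and u: "0 \<le> u" "u \<le> 1"
  obtains A where "A \<in> sets M"
    "T (L1_class M (\<lambda>\<omega>. indicator A \<omega> *\<^sub>R h \<omega>)) = T (L1_class M (\<lambda>\<omega>. u *\<^sub>R h \<omega>))"
proof -
  interpret finite_measure M using sat by (simp add: saturated_def)
  interpret F: normed_vs F using F by (simp add: separable_banach_vs_def banach_vs_def)
  have T_in: "T (L1_class M f) \<in> vcarrier F" if "integrable M f" for f
    using T L1_carrierI[OF that] by (auto simp: continuous_linear_vs_def)
  note T_add = continuous_linear_L1_add[OF T] and T_scale = continuous_linear_L1_scale[OF T]
  obtain B where "0 \<le> B" and B: "\<And>X. X \<in> vcarrier (L1 M) \<Longrightarrow> vnorm F (T X) \<le> B * vnorm (L1 M) X"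
    using continuous_linear_vs_bounded[OF normed_vs_L1 F.normed_vs_axioms T] by blast
  obtain Q where Q: "countable Q" "\<And>q. q \<in> Q \<Longrightarrow> F.linear_functional q"
    "\<And>q x. \<lbrakk>q \<in> Q; x \<in> vcarrier F\<rbrakk> \<Longrightarrow> \<bar>q x\<bar> \<le> vnorm F x"
    "\<And>x. \<lbrakk>x \<in> vcarrier F; \<And>q. q \<in> Q \<Longrightarrow> q x = 0\<rbrakk> \<Longrightarrow> x = vzero F"
    using F.separating_functionals F unfolding separable_banach_vs_def by blast
  define m where "m A = T (L1_class M (\<lambda>\<omega>. indicator A \<omega> *\<^sub>R h \<omega>))" for A
  have indh: "integrable M (\<lambda>\<omega>. indicator A \<omega> *\<^sub>R h \<omega>)" if "A \<in> sets M" for A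
    using integrable_mult_indicator[OF that h] .
  have m_in: "m A \<in> vcarrier F" if "A \<in> sets M" for A
    unfolding m_def using indh[OF that] by (rule T_in)
  have m_space: "m (space M) = T (L1_class M h)"
    unfolding m_def by (rule arg_cong[of _ _ T], rule L1_class_eqI) (auto intro: AE_I2)
  \<comment> \<open>Boundedness of T dominates each scalar measure by the indefinite integral of
    \<open>B * norm (h \<omega>)\<close>, as required for a density.\<close>
  have "\<exists>k. integrable M k \<and> (\<forall>A\<in>sets M. q (m A) = (\<integral>\<omega>. indicator A \<omega> * k \<omega> \<partial>M))" if q: "q \<in> Q" for q
  proof (rule obtain_density[of "\<lambda>\<omega>. B * norm (h \<omega>)" "\<lambda>A. q (m A)"])
    show "integrable M (\<lambda>\<omega>. B * norm (h \<omega>))" using h by simp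
    show "q (m (A \<union> C)) = q (m A) + q (m C)" if "A \<in> sets M" "C \<in> sets M" "A \<inter> C = {}" for A C
    proof -
      have "(\<lambda>\<omega>. indicator (A \<union> C) \<omega> *\<^sub>R h \<omega>) = (\<lambda>\<omega>. indicator A \<omega> *\<^sub>R h \<omega> + indicator C \<omega> *\<^sub>R h \<omega>)"
        using that(3) by (auto simp: fun_eq_iff indicator_def)
      then have "m (A \<union> C) = vadd F (m A) (m C)"
        using that(1,2) by (simp add: m_def T_add indh)
      then show ?thesis
        using Q(2)[OF q] that(1,2) by (simp add: F.linear_functional_def m_in)
    qed
    show "\<bar>q (m A)\<bar> \<le> (\<integral>\<omega>. indicator A \<omega> * (B * norm (h \<omega>)) \<partial>M)" if A: "A \<in> sets M" for A
    proof -
      have "\<bar>q (m A)\<bar> \<le> vnorm F (m A)" using Q(3)[OF q m_in[OF A]] .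
      also have "\<dots> \<le> B * (\<integral>\<omega>. norm (indicator A \<omega> *\<^sub>R h \<omega>) \<partial>M)"
        using B[OF L1_carrierI[OF indh[OF A]]] indh[OF A] by (simp add: m_def L1_norm)
      also have "\<dots> = (\<integral>\<omega>. indicator A \<omega> * (B * norm (h \<omega>)) \<partial>M)"
        by (subst integral_mult_right_zero[symmetric]) (simp add: mult.left_commute)
      finally show ?thesis .
    qed
  qed blast
  then obtain k where k: "\<And>q. q \<in> Q \<Longrightarrow> integrable M (k q)"
    "\<And>q A. \<lbrakk>q \<in> Q; A \<in> sets M\<rbrakk> \<Longrightarrow> q (m A) = (\<integral>\<omega>. indicator A \<omega> * k q \<omega> \<partial>M)"
    by metis
  obtain U :: "real set set" where U: "countable U" "topological_basis U"
    using ex_countable_basis by blast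
  have borel_U: "(borel :: real measure) = sigma UNIV U"
    by (rule borel_eq_countable_basis[OF U])
  \<comment> \<open>Preimages of basic open sets form a countable family whose generated
    sigma-algebra makes all the densities measurable at once.\<close>
  define P where "P = (\<lambda>(q, b). k q -` b \<inter> space M) ` (Q \<times> U)"
  have P: "countable P" unfolding P_def using Q(1) U(1) by auto
  have P_sets: "P \<subseteq> sets M"
    using topological_basis_open[OF U(2)] borel_measurable_integrable[OF k(1)]
    unfolding P_def by (auto intro!: measurable_sets)
  interpret S: finite_measure_subalgebra M "sigma (space M) P"
    by unfold_locales (rule subalgebra_sigma[OF P_sets])
  have P_Pow: "P \<subseteq> Pow (space M)" using P_sets sets.sets_into_space by blast
  have k_meas: "k q \<in> borel_measurable (sigma (space M) P)" if q: "q \<in> Q" for q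
    unfolding borel_U
  proof (rule measurable_measure_of)
    fix b assume "b \<in> U"
    then have "k q -` b \<inter> space M \<in> P" using q unfolding P_def by force
    then show "k q -` b \<inter> space (sigma (space M) P) \<in> sets (sigma (space M) P)"
      using P_Pow by (simp add: space_measure_of)
  qed auto
  obtain A where A: "A \<in> sets M" "AE \<omega> in M. S.cprob A \<omega> = u"
    using S.obtain_constant_cprob[OF saturated_imp_relatively_atomless[OF sat P P_sets] u] .
  have "q (m A) = u * q (m (space M))" if q: "q \<in> Q" for q
  proof -
    have "q (m (space M)) = (\<integral>\<omega>. indicator (space M) \<omega> * k q \<omega> \<partial>M)"
      by (rule k(2)[OF q]) simp
    also have "\<dots> = (\<integral>\<omega>. k q \<omega> \<partial>M)"
      by (rule Bochner_Integration.integral_cong) auto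
    finally show ?thesis
      using k(2)[OF q A(1)] S.integral_constant_cprob[OF A k(1)[OF q] k_meas[OF q]] by simp
  qed
  moreover have mu: "T (L1_class M (\<lambda>\<omega>. u *\<^sub>R h \<omega>)) = vscale F u (m (space M))"
    by (simp add: m_space T_scale h)
  \<comment> \<open>Every functional in \<open>Q\<close> annihilates the difference of the two
    values; since \<open>Q\<close> separates points, they coincide.\<close>
  ultimately have "q (vadd F (m A) (vscale F (-1) (T (L1_class M (\<lambda>\<omega>. u *\<^sub>R h \<omega>))))) = 0" if "q \<in> Q" for q
    using Q(2)[OF that] that m_in[OF A(1)] m_in[OF sets.top]
    by (simp add: F.linear_functional_def F.scale_closed)
  then have "vadd F (m A) (vscale F (-1) (T (L1_class M (\<lambda>\<omega>. u *\<^sub>R h \<omega>)))) = vzero F"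
    using m_in[OF A(1)] m_in[OF sets.top] mu by (intro Q(4)) (auto simp: F.add_closed F.scale_closed)
  then have "m A = T (L1_class M (\<lambda>\<omega>. u *\<^sub>R h \<omega>))"
    using F.diff_zero_iff[of "m A"] m_in[OF A(1)] m_in[OF sets.top] mu by (simp add: F.scale_closed)
  then show thesis using that A(1) by (simp add: m_def)
qed

text \<open>With h = f - g, the convex combination is u h + g. Under T the factor u may be exchanged
  for an indicator, which turns the sum into f on A and g off A, a member of K by
  decomposability.\<close>

lemma saturated_imp_convex_image:
  fixes K :: "('a \<Rightarrow> 'e::{banach, second_countable_topology}) set set"
  assumes sat: "saturated M" and K: "decomposable M K"
    and F: "separable_banach_vs F" and T: "continuous_linear_vs (L1 M) F T"
  shows "convex_vs F (T ` K)"
  unfolding convex_vs_def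
proof (intro ballI allI impI)
  fix x y and u v :: real
  assume xy: "x \<in> T ` K" "y \<in> T ` K" and uv: "0 \<le> u" "0 \<le> v" "u + v = 1"
  obtain X Y where XY: "X \<in> K" "x = T X" "Y \<in> K" "y = T Y" using xy by blast
  have "X \<in> vcarrier (L1 M)" "Y \<in> vcarrier (L1 M)" using XY K by (auto simp: decomposable_def)
  then obtain f g where f: "integrable M f" "X = L1_class M f" and g: "integrable M g" "Y = L1_class M g"
    by (elim L1_carrierE)
  define h where "h \<omega> = f \<omega> - g \<omega>" for \<omega>
  have h: "integrable M h" unfolding h_def using f(1) g(1) by simp
  have "u \<le> 1" using uv by simp
  then obtain A where A: "A \<in> sets M"
    "T (L1_class M (\<lambda>\<omega>. indicator A \<omega> *\<^sub>R h \<omega>)) = T (L1_class M (\<lambda>\<omega>. u *\<^sub>R h \<omega>))"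
    using saturated_obtain_set[OF sat F T h uv(1)] by blast
  note T_add = continuous_linear_L1_add[OF T] and T_scale = continuous_linear_L1_scale[OF T]
  have Ah: "integrable M (\<lambda>\<omega>. indicator A \<omega> *\<^sub>R h \<omega>)"
    using integrable_mult_indicator[OF A(1) h] .
  have v: "v = 1 - u" using uv by simp
  have "vadd F (vscale F u x) (vscale F v y) = T (L1_class M (\<lambda>\<omega>. u *\<^sub>R f \<omega> + v *\<^sub>R g \<omega>))"
    using f g XY by (simp add: T_add T_scale)
  also have "(\<lambda>\<omega>. u *\<^sub>R f \<omega> + v *\<^sub>R g \<omega>) = (\<lambda>\<omega>. u *\<^sub>R h \<omega> + g \<omega>)"
    by (simp add: h_def v algebra_simps)
  also have "T (L1_class M (\<lambda>\<omega>. u *\<^sub>R h \<omega> + g \<omega>)) = T (L1_class M (\<lambda>\<omega>. indicator A \<omega> *\<^sub>R h \<omega> + g \<omega>))"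
    using h g(1) A Ah by (simp add: T_add)
  also have "(\<lambda>\<omega>. indicator A \<omega> *\<^sub>R h \<omega> + g \<omega>)
      = (\<lambda>\<omega>. indicator A \<omega> *\<^sub>R f \<omega> + (1 - indicator A \<omega>) *\<^sub>R g \<omega>)"
    by (simp add: h_def algebra_simps)
  also have "T (L1_class M \<dots>) \<in> T ` K"
    using decomposable_mem[OF K A(1) f(1) g(1)] XY f g by blast
  finally show "vadd F (vscale F u x) (vscale F v y) \<in> T ` K" .
qed

subsection \<open>Measure spaces that are not saturated\<close>

definition L1_restrict :: "'a measure \<Rightarrow> 'a set \<Rightarrow> ('a \<Rightarrow> 'e) set \<Rightarrow> ('a \<Rightarrow> 'e::{banach, second_countable_topology}) set" where
  "L1_restrict M S X = L1_class (restrict_space M S) (L1_rep X)"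

text \<open>The choice of representative does not matter: functions equal almost everywhere for
  \<open>M\<close> remain so on \<open>S\<close>.\<close>

lemma
  fixes f :: "'a \<Rightarrow> 'e::{banach, second_countable_topology}"
  assumes S: "S \<in> sets M" and f: "integrable M f"
  shows integrable_on_restrict: "integrable (restrict_space M S) f"
    and L1_restrict_class: "L1_restrict M S (L1_class M f) = L1_class (restrict_space M S) f"
proof -
  have SM: "S \<inter> space M \<in> sets M" using S by auto
  show "integrable (restrict_space M S) f"
    using integrable_mult_indicator[OF S f] SM by (simp add: integrable_restrict_space)
  show "L1_restrict M S (L1_class M f) = L1_class (restrict_space M S) f"
    unfolding L1_restrict_def
    by (rule L1_class_eqI) (use SM L1_rep_AE[OF f] in \<open>auto simp: AE_restrict_space_iff elim: eventually_mono\<close>)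
qed

lemma continuous_linear_L1_restrict:
  assumes S: "S \<in> sets M"
  shows "continuous_linear_vs (L1 M) (L1 (restrict_space M S) :: ('a \<Rightarrow> 'e::{banach, second_countable_topology}) set nvs)
    (L1_restrict M S)"
proof (rule bounded_imp_continuous_linear_vs[OF normed_vs_L1 normed_vs_L1])
  let ?N = "restrict_space M S"
  note [simp] = L1_restrict_class[OF S] integrable_on_restrict[OF S] L1_carrierI
  show "L1_restrict M S \<in> vcarrier (L1 M) \<rightarrow> vcarrier (L1 ?N :: ('a \<Rightarrow> 'e) set nvs)"
    by (auto elim!: L1_carrierE)
  fix X :: "('a \<Rightarrow> 'e) set" assume "X \<in> vcarrier (L1 M)"
  then obtain f where f: "integrable M f" "X = L1_class M f" by (rule L1_carrierE)
  show "L1_restrict M S (vscale (L1 M) c X) = vscale (L1 ?N) c (L1_restrict M S X)" for c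
    using f by (simp add: L1_scale)
  have "(\<integral>\<omega>. norm (f \<omega>) \<partial>?N) = (\<integral>\<omega>. indicator S \<omega> * norm (f \<omega>) \<partial>M)"
    using S by (simp add: integral_restrict_space)
  also have "\<dots> \<le> (\<integral>\<omega>. norm (f \<omega>) \<partial>M)"
    using integrable_mult_indicator[OF S integrable_norm[OF f(1)]] f(1)
    by (intro integral_mono) (auto simp: indicator_def)
  finally show "vnorm (L1 ?N) (L1_restrict M S X) \<le> 1 * vnorm (L1 M) X"
    using f by (simp add: L1_norm)
  fix Y :: "('a \<Rightarrow> 'e) set" assume "Y \<in> vcarrier (L1 M)"
  then obtain g where g: "integrable M g" "Y = L1_class M g" by (rule L1_carrierE)
  show "L1_restrict M S (vadd (L1 M) X Y) = vadd (L1 ?N) (L1_restrict M S X) (L1_restrict M S Y)"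
    using f g by (simp add: L1_add)
qed

lemma continuous_linear_vs_compose:
  assumes "continuous_linear_vs U V R" "continuous_linear_vs V W T"
  shows "continuous_linear_vs U W (T \<circ> R)"
  using assms continuous_map_compose[of "vtopology U" "vtopology V" R "vtopology W" T]
  by (simp add: continuous_linear_vs_def Pi_iff)

text \<open>A countable dense set of real functions approximates all indicators, and this already
  gives separability for values in \<open>'e\<close>.\<close>

lemma separable_banach_L1:
  assumes "separable_space (vtopology (L1 N :: ('a \<Rightarrow> real) set nvs))"
  shows "separable_banach_vs (L1 N :: ('a \<Rightarrow> 'e::{banach, second_countable_topology}) set nvs)"
proof -
  obtain D :: "('a \<Rightarrow> real) set" where "countable D" "\<forall>d\<in>D. integrable N d"
    "\<forall>f. integrable N f \<longrightarrow> L1_approx N D f"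
    using assms unfolding separable_L1_iff by blast
  then have "separable_space (vtopology (L1 N :: ('a \<Rightarrow> 'e) set nvs))"
    by (intro separable_L1_if_indicators[of D]) auto
  then show ?thesis
    by (simp add: separable_banach_vs_def banach_vs_def normed_vs_L1 mcomplete_L1)
qed

text \<open>Pasting the indicator of A on C with that of B off C gives the indicator of
  \<open>C \<inter> A \<union> (B - C)\<close>.\<close>

lemma decomposable_indicators:
  fixes e :: "'e::{banach, second_countable_topology}"
  assumes "finite_measure M"
  shows "decomposable M ((\<lambda>A. L1_class M (\<lambda>\<omega>. indicator A \<omega> *\<^sub>R e)) ` sets M)"
  unfolding decomposable_def
proof (intro conjI ballI)
  interpret finite_measure M by fact
  have int: "integrable M (\<lambda>\<omega>. indicator A \<omega> *\<^sub>R e)" if "A \<in> sets M" for A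
    using that by (simp add: less_top[symmetric])
  then show "(\<lambda>A. L1_class M (\<lambda>\<omega>. indicator A \<omega> *\<^sub>R e)) ` sets M \<subseteq> vcarrier (L1 M)"
    by (auto intro: L1_carrierI)
  fix X Y C
  assume "X \<in> (\<lambda>A. L1_class M (\<lambda>\<omega>. indicator A \<omega> *\<^sub>R e)) ` sets M"
    "Y \<in> (\<lambda>A. L1_class M (\<lambda>\<omega>. indicator A \<omega> *\<^sub>R e)) ` sets M"
  then obtain A B where A: "A \<in> sets M" "X = L1_class M (\<lambda>\<omega>. indicator A \<omega> *\<^sub>R e)"
    and B: "B \<in> sets M" "Y = L1_class M (\<lambda>\<omega>. indicator B \<omega> *\<^sub>R e)" by blast
  assume C: "C \<in> sets M"
  have "L1_class M (\<lambda>\<omega>. indicator C \<omega> *\<^sub>R L1_rep X \<omega> + (1 - indicator C \<omega>) *\<^sub>R L1_rep Y \<omega>)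
      = L1_class M (\<lambda>\<omega>. indicator (C \<inter> A \<union> (B - C)) \<omega> *\<^sub>R e)"
    by (rule L1_class_eqI, rule eventually_elim2[OF L1_rep_AE[OF int[OF A(1)]] L1_rep_AE[OF int[OF B(1)]]])
      (auto simp: A(2) B(2) indicator_def)
  then show "L1_class M (\<lambda>\<omega>. indicator C \<omega> *\<^sub>R L1_rep X \<omega> + (1 - indicator C \<omega>) *\<^sub>R L1_rep Y \<omega>)
      \<in> (\<lambda>A. L1_class M (\<lambda>\<omega>. indicator A \<omega> *\<^sub>R e)) ` sets M"
    using A(1) B(1) C by (intro image_eqI[of _ _ "C \<inter> A \<union> (B - C)"]) auto
qed

text \<open>T restricts to a non-null \<open>S\<close> with separable L^1. The midpoint of the
  images of e and 0 would have to be an indicator times e on \<open>S\<close>, although 1/2 is not a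
  value of an indicator.\<close>

lemma not_saturated_obtain_nonconvex:
  fixes M :: "'a measure" and e :: "'e::{banach, second_countable_topology}"
  assumes fin: "finite_measure M" and nsat: "\<not> saturated M" and e: "e \<noteq> 0"
  obtains K :: "('a \<Rightarrow> 'e) set set" and F :: "(nat \<Rightarrow> real) nvs" and T
  where "K \<noteq> {}" "decomposable M K" "separable_banach_vs F" "continuous_linear_vs (L1 M) F T"
    "\<not> convex_vs F (T ` K)"
proof -
  interpret finite_measure M by fact
  obtain S where S: "S \<in> sets M" "0 < measure M S"
    "separable_space (vtopology (L1 (restrict_space M S) :: ('a \<Rightarrow> real) set nvs))"
    using nsat fin by (auto simp: saturated_def)
  let ?N = "restrict_space M S" and ?R = "L1_restrict M S :: ('a \<Rightarrow> 'e) set \<Rightarrow> _"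
  \<comment> \<open>L^1 over \<open>S\<close> consists of classes of functions, so it is carried
    over to the required type by an injective copy map.\<close>
  obtain F :: "(nat \<Rightarrow> real) nvs" and \<phi> where F: "separable_banach_vs F"
    "bij_betw \<phi> (vcarrier (L1 ?N :: ('a \<Rightarrow> 'e) set nvs)) (vcarrier F)"
    "continuous_linear_vs (L1 ?N) F \<phi>"
    using separable_banach_vs_copy[OF separable_banach_L1[OF S(3)]] by metis
  define T where "T = \<phi> \<circ> ?R"
  have T: "continuous_linear_vs (L1 M) F T"
    unfolding T_def by (rule continuous_linear_vs_compose[OF continuous_linear_L1_restrict[OF S(1)] F(3)])
  define \<kappa> where "\<kappa> A = L1_class M (\<lambda>\<omega>. indicator A \<omega> *\<^sub>R e)" for A
  have int: "integrable M (\<lambda>\<omega>. indicator A \<omega> *\<^sub>R e)" if "A \<in> sets M" for A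
    using that by (simp add: less_top[symmetric])
  have \<kappa>: "\<kappa> A \<in> vcarrier (L1 M)" if "A \<in> sets M" for A
    unfolding \<kappa>_def using int[OF that] by (rule L1_carrierI)
  have nc: "\<not> convex_vs F (T ` \<kappa> ` sets M)"
  proof
    assume "convex_vs F (T ` \<kappa> ` sets M)"
    then have "vadd F (vscale F (1/2) (T (\<kappa> (space M)))) (vscale F (1/2) (T (\<kappa> {}))) \<in> T ` \<kappa> ` sets M"
      by (simp add: convex_vs_def)
    then obtain A where A: "A \<in> sets M"
      "vadd F (vscale F (1/2) (T (\<kappa> (space M)))) (vscale F (1/2) (T (\<kappa> {}))) = T (\<kappa> A)" by blast
    let ?f = "\<lambda>\<omega>. (1/2) *\<^sub>R (indicator (space M) \<omega> *\<^sub>R e) + (1/2) *\<^sub>R (indicator {} \<omega> *\<^sub>R e)"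
    have f: "integrable M ?f"
      by (intro Bochner_Integration.integrable_add integrable_scaleR_right int) auto
    have "T (L1_class M ?f) = vadd F (vscale F (1/2) (T (\<kappa> (space M)))) (vscale F (1/2) (T (\<kappa> {})))"
      unfolding \<kappa>_def using int[OF sets.top] int[OF sets.empty_sets]
      by (subst continuous_linear_L1_add[OF T])
        (simp_all only: continuous_linear_L1_scale[OF T] integrable_scaleR_right)
    then have "\<phi> (L1_class ?N ?f) = \<phi> (L1_class ?N (\<lambda>\<omega>. indicator A \<omega> *\<^sub>R e))"
      using A(2) L1_restrict_class[OF S(1) f] L1_restrict_class[OF S(1) int[OF A(1)]]
      by (simp add: T_def \<kappa>_def)
    then have "L1_class ?N ?f = L1_class ?N (\<lambda>\<omega>. indicator A \<omega> *\<^sub>R e)"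
      by (rule inj_onD[OF bij_betw_imp_inj_on[OF F(2)]])
        (intro L1_carrierI integrable_on_restrict[OF S(1)] f int[OF A(1)])+
    then have "AE \<omega> in ?N. ?f \<omega> = indicator A \<omega> *\<^sub>R e"
      by (rule L1_class_eq_iff[OF integrable_on_restrict[OF S(1) f], THEN iffD1])
    then have "AE \<omega> in M. \<omega> \<in> S \<longrightarrow> ?f \<omega> = indicator A \<omega> *\<^sub>R e"
      by (subst (asm) AE_restrict_space_iff) (use S(1) in auto)
    then have "AE \<omega> in M. \<omega> \<notin> S"
      using AE_space
    proof eventually_elim
      case (elim \<omega>)
      show ?case
      proof
        assume "\<omega> \<in> S"
        with elim have "(1/2) *\<^sub>R e = indicator A \<omega> *\<^sub>R e" by simp
        then have "1/2 = (indicator A \<omega> :: real)" using e by (simp only: scaleR_cancel_right simp_thms)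
        then show False by (cases "\<omega> \<in> A") auto
      qed
    qed
    then have "measure M S = 0"
      using AE_iff_null_sets[OF S(1)] by (simp add: null_sets_def measure_def)
    then show False using S(2) by simp
  qed
  have dec: "decomposable M (\<kappa> ` sets M)"
    unfolding \<kappa>_def by (rule decomposable_indicators[OF fin])
  have "\<kappa> ` sets M \<noteq> {}" by auto
  then show thesis by (rule that[OF _ dec F(1) T nc])
qed

text \<open>The forward half lets \<open>F\<close> live on an arbitrary type \<open>'f\<close>. The
  converse assumes convexity for spaces on \<open>nat \<Rightarrow> real\<close>, where every
  separable Banach space has an isometric copy.\<close>

theorem theorem3p3:
  fixes M :: "'a measure"
  assumes "finite_measure M" and "complete_measure M"
  shows
    "(saturated M \<longrightarrow>
        (\<forall>(K :: ('a \<Rightarrow> 'e::{banach, second_countable_topology}) set set) (F :: 'f nvs) T.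
           K \<noteq> {} \<and> decomposable M K \<and> separable_banach_vs F \<and> continuous_linear_vs (L1 M) F T
           \<longrightarrow> convex_vs F (T ` K))) \<and>
     (\<not> (\<exists>B :: 'e set. finite B \<and> span B = UNIV) \<and>
        (\<forall>(K :: ('a \<Rightarrow> 'e) set set) (F :: (nat \<Rightarrow> real) nvs) T.
           K \<noteq> {} \<and> decomposable M K \<and> separable_banach_vs F \<and> continuous_linear_vs (L1 M) F T
           \<longrightarrow> convex_vs F (T ` K))
      \<longrightarrow> saturated M)"
proof (intro conjI impI allI)
  fix K :: "('a \<Rightarrow> 'e) set set" and F :: "'f nvs" and T :: "('a \<Rightarrow> 'e) set \<Rightarrow> 'f"
  assume "saturated M"
    "K \<noteq> {} \<and> decomposable M K \<and> separable_banach_vs F \<and> continuous_linear_vs (L1 M) F T"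
  then show "convex_vs F (T ` K)" by (simp add: saturated_imp_convex_image)
next
  assume *: "\<not> (\<exists>B :: 'e set. finite B \<and> span B = UNIV) \<and>
        (\<forall>(K :: ('a \<Rightarrow> 'e) set set) (F :: (nat \<Rightarrow> real) nvs) T.
           K \<noteq> {} \<and> decomposable M K \<and> separable_banach_vs F \<and> continuous_linear_vs (L1 M) F T
           \<longrightarrow> convex_vs F (T ` K))"
  \<comment> \<open>Infinite dimension provides a nonzero vector, since the zero space is spanned by
    the empty set.\<close>
  have "\<exists>e :: 'e. e \<noteq> 0"
  proof (rule ccontr)
    assume "\<not> ?thesis"
    then have "span {} = (UNIV :: 'e set)" by auto
    then show False using * finite.emptyI by blast
  qed
  then obtain e :: 'e where e: "e \<noteq> 0" by blast
  show "saturated M"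
  proof (rule ccontr)
    assume "\<not> saturated M"
    from not_saturated_obtain_nonconvex[OF assms(1) this e] * show False by metis
  qed
qed

end
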